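(* Let $d\ge2$, let $\Omega\subset\mathbf{R}^d$ be a bounded open $C^{1,1}$ set, and let $\phi, j, L, f$ be as in the context. Let $B$ be a relatively compact open set in $\Omega$ and let $u_1,u_2\in L^1(\mathbf{R}^d,(1\wedge j(|x|))dx)\cap C(\Omega)$ be such that $u_1$ is a distributional supersolution and $u_2$ a distributional subsolution to $$-Lu=-f(u)\quad\text{in }\Omega.$$ If $u_1\ge u_2$ on $\mathbf{R}^d\setminus B$, then $u_1\ge u_2$ on $\Omega$.
   Context: **Operator.** $\phi:[0,\infty)\to[0,\infty)$ is a complete Bernstein function with zero drift, i.e. $\phi(\lambda)=\int_0^\infty(1-e^{-\lambda s})\nu(s)\,ds$ with $\nu$ a completely monotone Lévy density, satisfying the scaling condition: there are $a_1,a_2>0$ and $0<\delta_1\le\delta_2<1$ with $a_1\lambda^{\delta_1}\le \phi(\lambda t)/\phi(t)\le a_2\lambda^{\delta_2}$ for all $\lambda\ge1$, $t\ge1$. $L=-\phi(-\Delta)$ is $Lu(x)=\mathrm{P.V.}\int_{\mathbf{R}^d}(u(y)-u(x))\,j(|y-x|)\,dy$, where $j(r)=\int_0^\infty(4\pi s)^{-d/2}e^{-r^2/(4s)}\nu(s)\,ds$. **Nonlinearity.** $f:\mathbf{R}\to[0,\infty)$ is an increasing (non-strict sense) $C^1$ function with $f(0)=0$ and $(1+m)f(t)\le tf'(t)\le(1+M)f(t)$, $t\in\mathbf{R}$, for some constants $0<m\le M$. **Distributional super/subsolutions.** $u$ is a distributional supersolution (respectively subsolution) of $-Lu=-f(u)$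 in $\Omega$ if for every $\xi\in C_c^\infty(\Omega)$, $\xi\ge0$, $\int_{\mathbf{R}^d}u\,(-L\xi)\,dx\ge-\int_\Omega f(u)\,\xi\,dx$ (respectively $\le$). Relatively compact in $\Omega$ means that the closure is a compact subset of $\Omega$. *)

theory Defs
  imports "HOL-Analysis.Analysis"
begin

section \<open>The operator\<close>

definition completely_monotone :: "(real \<Rightarrow> real) \<Rightarrow> bool" where
  "completely_monotone \<nu> \<longleftrightarrow>
     (\<forall>n. \<forall>s>0. ((deriv ^^ n) \<nu>) differentiable (at s) \<and> 0 \<le> (-1) ^ n * (deriv ^^ n) \<nu> s)"

text \<open>Non-negativity of a Levy density is not repeated here: below it is always combined with
  complete monotonicity, whose case \<open>n = 0\<close> is \<open>0 \<le> \<nu> s\<close>.\<close>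

definition levy_integrable :: "(real \<Rightarrow> real) \<Rightarrow> bool" where
  "levy_integrable \<nu> \<longleftrightarrow> set_integrable lborel {0<..} (\<lambda>s. min 1 s * \<nu> s)"

definition complete_bernstein_zero_drift :: "(real \<Rightarrow> real) \<Rightarrow> (real \<Rightarrow> real) \<Rightarrow> bool" where
  "complete_bernstein_zero_drift \<phi> \<nu> \<longleftrightarrow>
     completely_monotone \<nu> \<and> levy_integrable \<nu> \<and>
     (\<forall>x\<ge>0. \<phi> x = (LBINT s:{0<..}. (1 - exp (- (x * s))) * \<nu> s))"

definition scaling_condition :: "(real \<Rightarrow> real) \<Rightarrow> bool" where
  "scaling_condition \<phi> \<longleftrightarrow>
     (\<exists>a1 a2 \<delta>1 \<delta>2. 0 < a1 \<and> 0 < a2 \<and> 0 < \<delta>1 \<and> \<delta>1 \<le> \<delta>2 \<and> \<delta>2 < 1 \<and>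
        (\<forall>l\<ge>1. \<forall>t\<ge>1. a1 * l powr \<delta>1 \<le> \<phi> (l * t) / \<phi> t \<and>
                       \<phi> (l * t) / \<phi> t \<le> a2 * l powr \<delta>2))"

text \<open>The kernel \<open>j\<close> in dimension \<open>d\<close>. Only \<open>r > 0\<close> matters: at \<open>r = 0\<close> the integral diverges and
  the Bochner integral returns \<open>0\<close>, which affects a single point of space.\<close>

definition jump_kernel :: "nat \<Rightarrow> (real \<Rightarrow> real) \<Rightarrow> real \<Rightarrow> real" where
  "jump_kernel d \<nu> r =
     (LBINT s:{0<..}. (4 * pi * s) powr (- (real d / 2)) * exp (- (r\<^sup>2 / (4 * s))) * \<nu> s)"

text \<open>\<open>L = -\<phi>(-\<Delta>)\<close>, with the principal value as the limit of the integrals over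
  \<open>{y. \<epsilon> < \<bar>y - x\<bar>}\<close> for \<open>\<epsilon>\<close> decreasing to \<open>0\<close>.\<close>

definition levy_op :: "(real \<Rightarrow> real) \<Rightarrow> ('a::euclidean_space \<Rightarrow> real) \<Rightarrow> 'a \<Rightarrow> real" where
  "levy_op \<nu> u x =
     Lim (at_right 0) (\<lambda>\<epsilon>::real. LINT y:{y. \<epsilon> < norm (y - x)}|lebesgue.
       (u y - u x) * jump_kernel DIM('a) \<nu> (norm (y - x)))"

text \<open>The measure \<open>(1 \<and> j(\<bar>x\<bar>)) dx\<close>.\<close>

definition weighted_measure :: "(real \<Rightarrow> real) \<Rightarrow> 'a::euclidean_space measure" where
  "weighted_measure \<nu> =
     density lebesgue (\<lambda>x. ennreal (min 1 (jump_kernel DIM('a) \<nu> (norm x))))"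

section \<open>Super- and subsolutions\<close>

text \<open>\<open>C\<^sup>k\<close> on the whole space: all iterated directional derivatives up to order \<open>k\<close> exist as
  Frechet derivatives and are continuous.\<close>

primrec Ck :: "nat \<Rightarrow> ('a::euclidean_space \<Rightarrow> real) \<Rightarrow> bool" where
  "Ck 0 f \<longleftrightarrow> continuous_on UNIV f"
| "Ck (Suc k) f \<longleftrightarrow>
     (\<forall>x. f differentiable (at x)) \<and> (\<forall>v. Ck k (\<lambda>x. frechet_derivative f (at x) v))"

definition test_functions :: "'a::euclidean_space set \<Rightarrow> ('a \<Rightarrow> real) set" where
  "test_functions \<Omega> =
     {\<xi>. (\<forall>k. Ck k \<xi>) \<and> compact (closure {x. \<xi> x \<noteq> 0}) \<and> closure {x. \<xi> x \<noteq> 0} \<subseteq> \<Omega>}"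

definition distributional_supersolution ::
    "(real \<Rightarrow> real) \<Rightarrow> (real \<Rightarrow> real) \<Rightarrow> 'a::euclidean_space set \<Rightarrow> ('a \<Rightarrow> real) \<Rightarrow> bool" where
  "distributional_supersolution \<nu> f \<Omega> u \<longleftrightarrow>
     (\<forall>\<xi>\<in>test_functions \<Omega>. (\<forall>x. 0 \<le> \<xi> x) \<longrightarrow>
        (LINT x|lebesgue. u x * (- levy_op \<nu> \<xi> x)) \<ge> - (LINT x:\<Omega>|lebesgue. f (u x) * \<xi> x))"

definition distributional_subsolution ::
    "(real \<Rightarrow> real) \<Rightarrow> (real \<Rightarrow> real) \<Rightarrow> 'a::euclidean_space set \<Rightarrow> ('a \<Rightarrow> real) \<Rightarrow> bool" where
  "distributional_subsolution \<nu> f \<Omega> u \<longleftrightarrow>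
     (\<forall>\<xi>\<in>test_functions \<Omega>. (\<forall>x. 0 \<le> \<xi> x) \<longrightarrow>
        (LINT x|lebesgue. u x * (- levy_op \<nu> \<xi> x)) \<le> - (LINT x:\<Omega>|lebesgue. f (u x) * \<xi> x))"

section \<open>Open sets of class \<open>C\<^sup>1\<^sup>,\<^sup>1\<close>\<close>

text \<open>Localization radius \<open>R\<close> and constant \<open>\<Lambda>\<close> are uniform over the boundary. An orthonormal
  coordinate system with origin \<open>z\<close> is given by the unit vector \<open>e\<close> of its last axis; the copy of
  \<open>(d - 1)\<close>-dimensional space is the hyperplane \<open>H\<close> orthogonal to \<open>e\<close> (the choice of the other axes
  is immaterial), so \<open>y\<close> has last coordinate \<open>(y - z) \<bullet> e\<close> and the remaining coordinates
  \<open>(y - z) - ((y - z) \<bullet> e) *\<^sub>R e\<close>. The function \<open>\<psi>\<close> lives on \<open>H\<close> and \<open>g\<close> is its gradient.\<close>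

definition C11_open :: "'a::euclidean_space set \<Rightarrow> bool" where
  "C11_open D \<longleftrightarrow> open D \<and>
     (\<exists>R>0. \<exists>\<Lambda>>0. \<forall>z\<in>frontier D. \<exists>e \<psi> g. norm e = 1 \<and>
        (let H = {v. v \<bullet> e = 0} in
           \<psi> 0 = (0::real) \<and> g 0 = 0 \<and>
           (\<forall>v\<in>H. g v \<in> H \<and> (\<psi> has_derivative (\<lambda>h. g v \<bullet> h)) (at v within H) \<and> norm (g v) \<le> \<Lambda>) \<and>
           \<Lambda>-lipschitz_on H g) \<and>
        ball z R \<inter> D =
          {y \<in> ball z R. (y - z) \<bullet> e > \<psi> ((y - z) - ((y - z) \<bullet> e) *\<^sub>R e)})"

section \<open>The nonlinearity\<close>

definition admissible_nonlinearity :: "(real \<Rightarrow> real) \<Rightarrow> bool" where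
  "admissible_nonlinearity f \<longleftrightarrow>
     (\<forall>t. 0 \<le> f t) \<and> mono f \<and> f 0 = 0 \<and>
     (\<forall>t. f differentiable (at t)) \<and> continuous_on UNIV (deriv f) \<and>
     (\<exists>m M. 0 < m \<and> m \<le> M \<and>
        (\<forall>t. (1 + m) * f t \<le> t * deriv f t \<and> t * deriv f t \<le> (1 + M) * f t))"

end

theory Submission
  imports Defs "HOL-Probability.Distributions"
begin

text \<open>
  Put \<open>w = u1 - u2\<close>. Where \<open>w < 0\<close>, monotonicity of \<open>f\<close> gives \<open>f (u1 x) \<le> f (u2 x)\<close>, so there \<open>- L w \<ge> 0\<close>
  in the sense of distributions, while \<open>w \<ge> 0\<close> almost everywhere outside \<open>B\<close>. What is needed is thus a
  maximum principle for distributional supersolutions of \<open>- L w = 0\<close> on the open set where \<open>w\<close> is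
  negative (\<open>maximum_principle\<close>).

  It follows by mollification. Let \<open>\<xi>\<close> be a smooth bump of small radius centred at the point \<open>c\<close> where the
  mollification \<open>W\<close> of \<open>w\<close> is minimal. If \<open>w\<close> is negative somewhere, this minimum is negative, is attained
  well inside the set \<open>w < 0\<close>, and is strict away from the compact closure of \<open>B\<close>. Testing with \<open>\<xi>\<close> yields
  \<open>\<integral> w (L \<xi>) \<le> 0\<close>. On the other hand, moving the operator to \<open>W\<close> by Fubini's theorem, this
  integral is half of \<open>\<integral> (W (c + h) + W (c - h) - 2 W c) J h dh\<close> with the kernel \<open>J h = j \<bar>h\<bar>\<close>, which is positive
  (\<open>symmetric_op_duality\<close>, \<open>bump_average_minimum\<close>).

  The work is in the absolute convergence that Fubini's theorem requires: \<open>L \<xi>\<close> must be bounded by a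
  multiple of the weight \<open>min 1 (J y)\<close> for which \<open>u1\<close> and \<open>u2\<close> are integrable (\<open>second_difference_decay\<close>). Near the support of
  \<open>\<xi>\<close> this needs that \<open>J\<close> is a Levy density (\<open>integrable_jump_kernel\<close>), and at infinity that \<open>j r\<close> is at most
  a constant times \<open>j (r + 1)\<close> (\<open>jump_kernel_shift\<close>). The latter rests on the log-convexity of the completely
  monotone density \<open>\<nu>\<close> (\<open>completely_monotone_log_convex\<close>), which bounds \<open>\<nu> s\<close> by a multiple of \<open>\<nu> (s + 1)\<close>
  for \<open>s \<ge> 1\<close>; it is obtained from finite differences, without the representation of completely monotone
  functions as Laplace transforms. The scaling condition excludes \<open>\<nu> = 0\<close>.
\<close>

section \<open>Log-convexity of completely monotone functions\<close>

text \<open>A sequence of functions on the half-line \<open>s > 0\<close>, each the derivative of its predecessor, with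
the alternating signs of the derivatives of a completely monotone function. Carrying the
derivatives along makes the class visibly closed under differences.\<close>
definition cm_family :: "(nat \<Rightarrow> real \<Rightarrow> real) \<Rightarrow> bool" where
  "cm_family F \<longleftrightarrow>
     (\<forall>n. \<forall>s>0. (F n has_real_derivative F (Suc n) s) (at s) \<and> 0 \<le> (-1) ^ n * F n s)"

lemma cm_family_iterated_deriv:
  assumes "completely_monotone \<nu>"
  shows "cm_family (\<lambda>n. (deriv ^^ n) \<nu>)"
  unfolding cm_family_def
proof (intro allI impI conjI)
  fix n and s :: real assume "0 < s"
  then have "(deriv ^^ n) \<nu> differentiable (at s)"
    using assms unfolding completely_monotone_def by blast
  then show "((deriv ^^ n) \<nu> has_real_derivative (deriv ^^ Suc n) \<nu> s) (at s)"
    by (simp add: DERIV_deriv_iff_real_differentiable)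
  show "0 \<le> (-1) ^ n * (deriv ^^ n) \<nu> s"
    using assms \<open>0 < s\<close> unfolding completely_monotone_def by blast
qed

lemma cm_family_antimono:
  assumes "cm_family F" "0 < s" "s \<le> t"
  shows "(-1) ^ n * F n t \<le> (-1) ^ n * F n s"
proof (rule DERIV_nonpos_imp_nonincreasing[OF \<open>s \<le> t\<close>])
  fix x assume "s \<le> x" "x \<le> t"
  then have "0 < x" using \<open>0 < s\<close> by simp
  then have "(F n has_real_derivative F (Suc n) x) (at x)" "0 \<le> (-1) ^ Suc n * F (Suc n) x"
    using assms(1) unfolding cm_family_def by blast+
  then show "\<exists>y. ((\<lambda>x. (-1) ^ n * F n x) has_real_derivative y) (at x) \<and> y \<le> 0"
    by (intro exI[of _ "(-1) ^ n * F (Suc n) x"]) (auto intro!: DERIV_cmult)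
qed

lemma cm_family_difference:
  assumes "cm_family F" "0 < h"
  shows "cm_family (\<lambda>n s. F n s - F n (s + h))"
  unfolding cm_family_def
proof (intro allI impI conjI)
  fix n and s :: real assume "0 < s"
  have "(F n has_real_derivative F (Suc n) s) (at s)"
    "(F n has_real_derivative F (Suc n) (s + h)) (at (s + h))"
    using assms \<open>0 < s\<close> unfolding cm_family_def by simp_all
  then show "((\<lambda>s. F n s - F n (s + h)) has_real_derivative F (Suc n) s - F (Suc n) (s + h)) (at s)"
    by (intro DERIV_diff) (auto simp: DERIV_shift)
  show "0 \<le> (-1) ^ n * (F n s - F n (s + h))"
    using cm_family_antimono[OF assms(1) \<open>0 < s\<close>, of "s + h" n] \<open>0 < h\<close>
    by (simp add: right_diff_distrib)
qed

text \<open>Read \<open>D n k\<close> as the \<open>n\<close>-th difference of a sequence at \<open>k\<close>: the recursion says that difference plus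
shift is the identity, and the lemma expands the \<open>N\<close>-th power of this identity.\<close>
lemma bernstein_sum:
  fixes D :: "nat \<Rightarrow> nat \<Rightarrow> real"
  assumes "\<And>n k. D n k = D (Suc n) k + D n (Suc k)"
  shows "(\<Sum>k\<le>N. real (N choose k) * D (N - k) (k + i)) = D 0 i"
proof (induction N arbitrary: i)
  case 0 show ?case by simp
next
  case (Suc N)
  have "(\<Sum>k\<le>Suc N. real (Suc N choose k) * D (Suc N - k) (k + i))
      = D (Suc N) i + (\<Sum>k\<le>N. real (Suc N choose Suc k) * D (N - k) (Suc k + i))"
    by (subst sum.atMost_Suc_shift) simp
  also have "(\<Sum>k\<le>N. real (Suc N choose Suc k) * D (N - k) (Suc k + i))
      = (\<Sum>k\<le>N. real (N choose k) * D (N - k) (k + Suc i))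
        + (\<Sum>k\<le>N. real (N choose Suc k) * D (N - k) (Suc k + i))"
    by (simp add: sum.distrib algebra_simps)
  also have "D (Suc N) i + (\<dots>) = (\<Sum>k\<le>N. real (N choose k) * D (N - k) (k + Suc i))
      + (\<Sum>k\<le>Suc N. real (N choose k) * D (Suc N - k) (k + i))"
    by (subst sum.atMost_Suc_shift) simp
  also have "(\<Sum>k\<le>Suc N. real (N choose k) * D (Suc N - k) (k + i))
      = (\<Sum>k\<le>N. real (N choose k) * D (Suc (N - k)) (k + i))"
    by (simp add: Suc_diff_le)
  also have "(\<Sum>k\<le>N. real (N choose k) * D (N - k) (k + Suc i)) + \<dots>
      = (\<Sum>k\<le>N. real (N choose k) * (D (Suc (N - k)) (k + i) + D (N - k) (Suc (k + i))))"
    by (simp add: sum.distrib algebra_simps)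
  also have "\<dots> = D 0 i"
    using Suc.IH[of i] by (simp only: assms[symmetric])
  finally show ?case .
qed

text \<open>A sequence all of whose alternating differences are non-negative is log-convex. This is the
Cauchy-Schwarz inequality for the moments of its (fictitious) representing measure on \<open>[0,1]\<close>,
which is approximated here by the masses \<open>c k\<close> at the points \<open>k/N\<close>: their moments of order \<open>0, 1, 2\<close>
are computed exactly and tend to \<open>D 0 0\<close>, \<open>D 0 1\<close>, \<open>D 0 2\<close>.\<close>
lemma log_convex_of_differences:
  fixes D :: "nat \<Rightarrow> nat \<Rightarrow> real"
  assumes rec: "\<And>n k. D n k = D (Suc n) k + D n (Suc k)"
    and nonneg: "\<And>n k. 0 \<le> D n k"
  shows "(D 0 1)\<^sup>2 \<le> D 0 0 * D 0 2"
proof -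
  have key: "(D 0 1)\<^sup>2 \<le> D 0 0 * (D 0 2 + (D 0 1 - D 0 2) * inverse (real (Suc (Suc M))))" for M
  proof -
    define N where "N = Suc (Suc M)"
    define c where "c k = real (N choose k) * D (N - k) k" for k
    have c0: "0 \<le> c k" for k unfolding c_def using nonneg by simp
    have s0: "(\<Sum>k\<le>N. c k) = D 0 0"
      using bernstein_sum[of D, OF rec, where N=N and i=0] by (simp add: c_def)
    have "(\<Sum>k\<le>N. real k * c k) = (\<Sum>k\<le>Suc M. real (Suc k) * c (Suc k))"
      unfolding N_def by (subst sum.atMost_Suc_shift) simp
    also have "\<dots> = (\<Sum>k\<le>Suc M. real N * (real (Suc M choose k) * D (Suc M - k) (k + 1)))"
    proof (rule sum.cong[OF refl])
      fix k
      have "real (Suc k) * real (N choose Suc k) = real N * real (Suc M choose k)"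
        unfolding N_def of_nat_mult[symmetric] by (simp only: Suc_times_binomial_eq mult.commute)
      then show "real (Suc k) * c (Suc k) = real N * (real (Suc M choose k) * D (Suc M - k) (k + 1))"
        unfolding c_def N_def by (simp del: of_nat_Suc binomial_Suc_Suc add: mult.assoc[symmetric])
    qed
    also have "\<dots> = real N * D 0 1"
      by (simp only: sum_distrib_left[symmetric] bernstein_sum[of D, OF rec])
    finally have s1: "(\<Sum>k\<le>N. real k * c k) = real N * D 0 1" .
    have "(\<Sum>k\<le>N. real k * (real k - 1) * c k)
        = (\<Sum>k\<le>M. real (Suc (Suc k)) * real (Suc k) * c (Suc (Suc k)))"
      unfolding N_def by (subst sum.atMost_Suc_shift, subst sum.atMost_Suc_shift) simp
    also have "\<dots> = (\<Sum>k\<le>M. real N * real (Suc M) * (real (M choose k) * D (M - k) (k + 2)))"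
    proof (rule sum.cong[OF refl])
      fix k
      have "real (Suc (Suc k)) * real (N choose Suc (Suc k)) = real N * real (Suc M choose Suc k)"
        unfolding N_def of_nat_mult[symmetric] by (simp only: Suc_times_binomial_eq mult.commute)
      moreover have "real (Suc k) * real (Suc M choose Suc k) = real (Suc M) * real (M choose k)"
        unfolding of_nat_mult[symmetric] by (simp only: Suc_times_binomial_eq mult.commute)
      ultimately have "real (Suc (Suc k)) * real (Suc k) * real (N choose Suc (Suc k))
          = real N * real (Suc M) * real (M choose k)"
        by (metis mult.assoc mult.left_commute)
      then show "real (Suc (Suc k)) * real (Suc k) * c (Suc (Suc k))
          = real N * real (Suc M) * (real (M choose k) * D (M - k) (k + 2))"
        unfolding c_def N_def by (simp del: of_nat_Suc binomial_Suc_Suc add: mult.assoc[symmetric])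
    qed
    also have "\<dots> = real N * real (Suc M) * D 0 2"
      by (simp only: sum_distrib_left[symmetric] bernstein_sum[of D, OF rec])
    finally have s2: "(\<Sum>k\<le>N. real k * (real k - 1) * c k) = real N * (real N - 1) * D 0 2"
      by (simp add: N_def)
    have s3: "(\<Sum>k\<le>N. (real k)\<^sup>2 * c k) = real N * (real N - 1) * D 0 2 + real N * D 0 1"
      unfolding s1[symmetric] s2[symmetric] sum.distrib[symmetric]
      by (intro sum.cong) (auto simp: algebra_simps power2_eq_square)
    have "(\<Sum>k\<le>N. sqrt (c k) * (real k * sqrt (c k)))\<^sup>2
        \<le> (\<Sum>k\<le>N. (sqrt (c k))\<^sup>2) * (\<Sum>k\<le>N. (real k * sqrt (c k))\<^sup>2)"
      by (rule Cauchy_Schwarz_ineq_sum)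
    also have "(\<Sum>k\<le>N. sqrt (c k) * (real k * sqrt (c k))) = (\<Sum>k\<le>N. real k * c k)"
      using c0 by (intro sum.cong) (auto simp: algebra_simps)
    finally have "(real N * D 0 1)\<^sup>2
        \<le> D 0 0 * (real N * (real N - 1) * D 0 2 + real N * D 0 1)"
      using c0 by (simp add: s1 s0 s3 power_mult_distrib)
    moreover have "0 < real N" by (simp add: N_def)
    moreover from this have "D 0 0 * (real N * (real N - 1) * D 0 2 + real N * D 0 1)
        = (real N)\<^sup>2 * (D 0 0 * (D 0 2 + (D 0 1 - D 0 2) * inverse (real N)))"
      by (simp add: power2_eq_square field_simps)
    ultimately have "(real N)\<^sup>2 * (D 0 1)\<^sup>2
        \<le> (real N)\<^sup>2 * (D 0 0 * (D 0 2 + (D 0 1 - D 0 2) * inverse (real N)))"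
      by (simp only: power_mult_distrib)
    then show ?thesis using \<open>0 < real N\<close> unfolding N_def[symmetric] by simp
  qed
  have "(\<lambda>M. inverse (real (Suc (Suc M)))) \<longlonglongrightarrow> 0"
    using LIMSEQ_inverse_real_of_nat LIMSEQ_Suc by blast
  then have "(\<lambda>M. D 0 0 * (D 0 2 + (D 0 1 - D 0 2) * inverse (real (Suc (Suc M)))))
      \<longlonglongrightarrow> D 0 0 * (D 0 2 + (D 0 1 - D 0 2) * 0)"
    by (intro tendsto_intros)
  from LIMSEQ_le_const[OF this, of "(D 0 1)\<^sup>2"] key show ?thesis by auto
qed

lemma completely_monotone_nonneg:
  assumes "completely_monotone \<nu>" "0 < s" shows "0 \<le> \<nu> s"
  using cm_family_iterated_deriv[OF assms(1)] assms(2) unfolding cm_family_def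
  by (metis funpow_0 mult_1 power_0)

lemma completely_monotone_antimono:
  assumes "completely_monotone \<nu>" "0 < s" "s \<le> t" shows "\<nu> t \<le> \<nu> s"
  using cm_family_antimono[OF cm_family_iterated_deriv[OF assms(1)] assms(2,3), of 0] by simp

text \<open>Iterated differences with step \<open>h\<close> of a completely monotone function are non-negative, so its
values on an arithmetic progression form a log-convex sequence.\<close>
lemma completely_monotone_log_convex:
  assumes cm: "completely_monotone \<nu>" and "0 < t" "0 < h"
  shows "(\<nu> (t + h))\<^sup>2 \<le> \<nu> t * \<nu> (t + 2 * h)"
proof -
  define \<Delta> where "\<Delta> G = (\<lambda>n s. G n s - G n (s + h) :: real)" for G :: "nat \<Rightarrow> real \<Rightarrow> real"
  define E where "E = (\<lambda>n. (\<Delta> ^^ n) (\<lambda>n. (deriv ^^ n) \<nu>))"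
  define D where "D n k = E n 0 (t + real k * h)" for n k
  have E: "cm_family (E n)" for n
  proof (induction n)
    case 0 show ?case using cm_family_iterated_deriv[OF cm] by (simp add: E_def)
  next
    case (Suc n)
    have "E (Suc n) = \<Delta> (E n)" by (simp add: E_def)
    then show ?case using cm_family_difference[OF Suc \<open>0 < h\<close>] by (simp add: \<Delta>_def)
  qed
  have "D n k = D (Suc n) k + D n (Suc k)" for n k
    by (simp add: D_def E_def \<Delta>_def algebra_simps)
  moreover have "0 \<le> D n k" for n k
  proof -
    have "0 < t + real k * h" using \<open>0 < t\<close> \<open>0 < h\<close> by (simp add: add_pos_nonneg)
    then have "0 \<le> (-1) ^ 0 * E n 0 (t + real k * h)"
      using E[of n] unfolding cm_family_def by blast
    then show ?thesis by (simp add: D_def)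
  qed
  ultimately have "(D 0 1)\<^sup>2 \<le> D 0 0 * D 0 2" by (rule log_convex_of_differences)
  then show ?thesis by (simp add: D_def E_def)
qed

text \<open>Log-convexity propagates a zero at \<open>r\<close> to \<open>3r/4\<close>, hence towards the origin; by monotonicity a single
zero makes the function vanish everywhere.\<close>
lemma completely_monotone_pos:
  assumes cm: "completely_monotone \<nu>" and "0 < t" "\<nu> t \<noteq> 0" "0 < s"
  shows "0 < \<nu> s"
proof (rule ccontr)
  assume "\<not> 0 < \<nu> s"
  then have s: "\<nu> s = 0" using completely_monotone_nonneg[OF cm \<open>0 < s\<close>] by simp
  have zero: "\<nu> ((3/4) ^ n * s) = 0" for n
  proof (induction n)
    case 0 show ?case using s by simp
  next
    case (Suc n)
    define r where "r = (3/4) ^ n * s"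
    have "0 < r" using \<open>0 < s\<close> by (simp add: r_def)
    then have "(\<nu> (r / 2 + r / 4))\<^sup>2 \<le> \<nu> (r / 2) * \<nu> (r / 2 + 2 * (r / 4))"
      by (intro completely_monotone_log_convex[OF cm]) auto
    moreover have "r / 2 + 2 * (r / 4) = r" "r / 2 + r / 4 = (3/4) ^ Suc n * s"
      by (simp_all add: r_def)
    moreover have "\<nu> r = 0" using Suc by (simp add: r_def)
    ultimately have "(\<nu> ((3/4) ^ Suc n * s))\<^sup>2 \<le> 0" by (simp only: mult_zero_right)
    then show ?case by (simp only: power2_less_eq_zero_iff)
  qed
  have "(\<lambda>n. (3/4) ^ n * s) \<longlonglongrightarrow> 0 * s" by (intro tendsto_intros LIMSEQ_power_zero) simp
  then have "eventually (\<lambda>n. (3/4) ^ n * s < t) sequentially"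
    using \<open>0 < t\<close> by (intro order_tendstoD(2)) auto
  then obtain n where "(3/4) ^ n * s < t" by (auto simp: eventually_sequentially)
  then have "\<nu> t \<le> \<nu> ((3/4) ^ n * s)"
    using \<open>0 < s\<close> by (intro completely_monotone_antimono[OF cm]) auto
  then show False
    using zero[of n] \<open>\<nu> t \<noteq> 0\<close> completely_monotone_nonneg[OF cm \<open>0 < t\<close>] by simp
qed

text \<open>By log-convexity the ratio of \<open>\<nu> (s + 1)\<close> to \<open>\<nu> s\<close> grows along \<open>s, s + 1, s + 2, ...\<close>, so its
minimum over \<open>s \<ge> 1\<close> is governed by \<open>1 \<le> s \<le> 2\<close>.\<close>
lemma completely_monotone_shift:
  assumes cm: "completely_monotone \<nu>" and pos: "\<And>s. 0 < s \<Longrightarrow> 0 < \<nu> s" and "1 \<le> s"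
  shows "\<nu> s \<le> \<nu> 1 / \<nu> 3 * \<nu> (s + 1)"
proof -
  have "\<nu> (x + real n) \<le> \<nu> 1 / \<nu> 3 * \<nu> (x + real n + 1)" if "1 \<le> x" "x \<le> 2" for x n
  proof (induction n)
    case 0
    have "\<nu> x * \<nu> 3 \<le> \<nu> 1 * \<nu> (x + 1)"
      using that pos[of 1] pos[of 3]
      by (intro mult_mono completely_monotone_antimono[OF cm] less_imp_le[OF pos]) auto
    then show ?case using pos[of 3] by (simp add: field_simps)
  next
    case (Suc n)
    define t where "t = x + real n"
    have t: "0 < t" using that by (simp add: t_def)
    have "(\<nu> (t + 1))\<^sup>2 \<le> \<nu> t * \<nu> (t + 2)"
      using completely_monotone_log_convex[OF cm t, of 1] by simp
    also have "\<dots> \<le> \<nu> 1 / \<nu> 3 * \<nu> (t + 1) * \<nu> (t + 2)"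
      using Suc pos[of "t + 2"] t by (intro mult_right_mono) (auto simp: t_def)
    finally have "\<nu> (t + 1) * \<nu> (t + 1) \<le> (\<nu> 1 / \<nu> 3 * \<nu> (t + 2)) * \<nu> (t + 1)"
      by (simp add: power2_eq_square mult_ac)
    then have "\<nu> (t + 1) \<le> \<nu> 1 / \<nu> 3 * \<nu> (t + 2)"
      using pos[of "t + 1"] t by (simp only: mult_le_cancel_right_pos)
    then show ?case by (simp add: t_def algebra_simps)
  qed
  from this[of "s - real (nat \<lfloor>s - 1\<rfloor>)" "nat \<lfloor>s - 1\<rfloor>"] show ?thesis
    using \<open>1 \<le> s\<close> by (simp add: of_nat_nat) linarith
qed

section \<open>The jump kernel of a completely monotone Levy density\<close>

text \<open>A completely monotone Levy density that does not vanish identically.\<close>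
locale cm_levy_density =
  fixes \<nu> :: "real \<Rightarrow> real"
  assumes cm: "completely_monotone \<nu>"
    and levy: "levy_integrable \<nu>"
    and nontrivial: "\<exists>t>0. \<nu> t \<noteq> 0"
begin

lemma nu_pos: "0 < s \<Longrightarrow> 0 < \<nu> s"
  using nontrivial completely_monotone_pos[OF cm] by blast

lemma nu_antimono: "0 < s \<Longrightarrow> s \<le> t \<Longrightarrow> \<nu> t \<le> \<nu> s"
  by (rule completely_monotone_antimono[OF cm])

lemma nu_measurable [measurable]: "(\<lambda>s. indicator {0<..} s * \<nu> s) \<in> borel_measurable borel"
proof -
  have "continuous_on {0<..} \<nu>"
  proof (rule continuous_at_imp_continuous_on, rule ballI)
    fix s :: real assume "s \<in> {0<..}"
    then have "\<nu> differentiable (at s)"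
      using cm unfolding completely_monotone_def by (metis funpow_0 greaterThan_iff)
    then show "isCont \<nu> s" by (rule differentiable_imp_continuous_within)
  qed
  from borel_measurable_continuous_on_indicator[OF _ this] show ?thesis by simp
qed

lemma nu_integrable: "integrable lborel (\<lambda>s. min 1 s * (indicator {0<..} s * \<nu> s))"
  using levy unfolding levy_integrable_def set_integrable_def by (simp add: mult_ac)

text \<open>By monotonicity, \<open>\<nu> s\<close> is at most its average against \<open>x dx\<close> over \<open>[s/2, s]\<close>.\<close>
lemma nu_quadratic_bound: "\<exists>K>0. \<forall>s. 0 < s \<longrightarrow> s \<le> 1 \<longrightarrow> \<nu> s \<le> K / s\<^sup>2"
proof -
  define I where "I = (\<integral>s. min 1 s * (indicator {0<..} s * \<nu> s) \<partial>lborel)"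
  have bound: "s / 2 * \<nu> s * (s / 2) \<le> I" if s: "0 < s" "s \<le> 1" for s
  proof -
    have "s / 2 * \<nu> s * (s / 2) = (\<integral>x. indicator {s/2..s} x * (s / 2 * \<nu> s) \<partial>lborel)"
      using s by simp
    also have "\<dots> \<le> I" unfolding I_def
    proof (rule integral_mono[OF _ nu_integrable])
      show "integrable lborel (\<lambda>x. indicator {s/2..s} x * (s / 2 * \<nu> s))"
        by (intro integrable_mult_left integrable_real_indicator) (auto simp: emeasure_lborel_Icc_eq)
      fix x :: real
      have "s / 2 * \<nu> s \<le> x * \<nu> x" if "s / 2 \<le> x" "x \<le> s"
        using that s nu_antimono[of x s] nu_pos[of s] by (intro mult_mono) auto
      then show "indicator {s/2..s} x * (s / 2 * \<nu> s) \<le> min 1 x * (indicator {0<..} x * \<nu> x)"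
        using s nu_pos[of x] by (cases "x \<le> s") (auto simp: indicator_def)
    qed
    finally show ?thesis .
  qed
  have "0 < I" using bound[of 1] nu_pos[of 1] by simp
  moreover have "\<nu> s \<le> 4 * I / s\<^sup>2" if "0 < s" "s \<le> 1" for s
    using bound[OF that] that by (simp add: field_simps power2_eq_square)
  ultimately show ?thesis by (intro exI[of _ "4 * I"]) auto
qed

end

text \<open>The exponential factor of the heat kernel beats every negative power of the time near \<open>0\<close>, with
room for one more factor \<open>s\<close>.\<close>
lemma powr_exp_inverse_bound:
  fixes a c :: real
  assumes "0 \<le> a" "0 < c"
  shows "\<exists>C>0. \<forall>s>0. s powr (- a) * exp (- (c / s)) \<le> C * min 1 s"
proof -
  define k where "k = nat \<lceil>a\<rceil> + 1"
  have k: "a + 1 \<le> real k" "1 \<le> k" unfolding k_def using assms by linarith+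
  \<comment> \<open>The constant comes from \<open>exp x \<ge> (x / k) ^ k\<close>.\<close>
  define C where "C = max 1 ((real k / c) ^ k)"
  have "s powr (- a) * exp (- (c / s)) \<le> C * min 1 s" if s: "0 < s" for s
  proof (cases "s \<le> 1")
    case True
    have "c / (real k * s) \<le> exp (c / (real k * s))"
      using exp_ge_add_one_self[of "c / (real k * s)"] by linarith
    then have "(c / (real k * s)) ^ k \<le> exp (c / (real k * s)) ^ k"
      using assms s by (intro power_mono) auto
    also have "\<dots> = exp (c / s)"
      using k by (simp add: exp_of_nat_mult[symmetric])
    finally have "exp (- (c / s)) \<le> inverse ((c / (real k * s)) ^ k)"
      using assms s k unfolding exp_minus by (intro le_imp_inverse_le) auto
    also have "\<dots> = (real k / c) ^ k * s ^ k"
      by (simp add: power_inverse[symmetric] power_mult_distrib[symmetric])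
    finally have "s powr (- a) * exp (- (c / s)) \<le> s powr (- a) * ((real k / c) ^ k * s ^ k)"
      by (intro mult_left_mono) auto
    also have "\<dots> = (real k / c) ^ k * s powr (real k - a)"
      using s by (simp add: powr_realpow[symmetric] powr_add[symmetric] mult_ac)
    also have "\<dots> \<le> C * s powr 1"
      using s True k assms unfolding C_def
      by (intro mult_mono powr_mono') auto
    finally show ?thesis using s True by simp
  next
    case False
    then have "s powr (- a) \<le> s powr 0" using assms by (intro powr_mono) auto
    then have "s powr (- a) \<le> 1" using s by simp
    moreover have "exp (- (c / s)) \<le> 1" using assms s by simp
    ultimately have "s powr (- a) * exp (- (c / s)) \<le> 1 * 1" by (intro mult_mono) auto
    then show ?thesis using False by (simp add: C_def min_def)
  qed
  then show ?thesis by (intro exI[of _ C]) (auto simp: C_def)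
qed

text \<open>The heat kernel of \<open>\<Delta>\<close> in dimension \<open>d\<close> at time \<open>s\<close>, as a function of the radius \<open>r\<close>; \<open>jump_kernel\<close> is
its mixture over \<open>s\<close> with weight \<open>\<nu>\<close>.\<close>
definition heat :: "nat \<Rightarrow> real \<Rightarrow> real \<Rightarrow> real" where
  "heat d s r = (4 * pi * s) powr (- (real d / 2)) * exp (- (r\<^sup>2 / (4 * s)))"

lemma heat_measurable [measurable]:
  "(\<lambda>x. heat d (f x) (g x)) \<in> borel_measurable M"
  if [measurable]: "f \<in> borel_measurable M" "g \<in> borel_measurable M"
  unfolding heat_def by measurable

lemma heat_nonneg [simp]: "0 \<le> heat d s r"
  by (simp add: heat_def)

lemma heat_pos: "0 < s \<Longrightarrow> 0 < heat d s r"
  by (simp add: heat_def)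

lemma heat_antimono: "0 < s \<Longrightarrow> 0 \<le> r \<Longrightarrow> r \<le> r' \<Longrightarrow> heat d s r' \<le> heat d s r"
  unfolding heat_def by (intro mult_left_mono) (auto intro!: divide_right_mono power_mono)

lemma heat_eq:
  "0 < s \<Longrightarrow> heat d s r = (4 * pi) powr (- (real d / 2)) * (s powr (- (real d / 2)) * exp (- (r\<^sup>2 / 4 / s)))"
  unfolding heat_def by (simp add: powr_mult)

lemma heat_as_product:
  fixes x :: "'a::euclidean_space"
  assumes "0 < s"
  shows "heat DIM('a) s (norm x) = (\<Prod>b\<in>Basis. normal_density 0 (sqrt (2 * s)) (x \<bullet> b))"
proof -
  have "(\<Prod>b\<in>Basis. normal_density 0 (sqrt (2 * s)) (x \<bullet> b))
      = (\<Prod>b\<in>(Basis::'a set). 1 / sqrt (4 * pi * s)) * (\<Prod>b\<in>Basis. exp (- ((x \<bullet> b)\<^sup>2 / (4 * s))))"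
    unfolding prod.distrib[symmetric] normal_density_def using assms
    by (intro prod.cong) (auto simp: mult_ac)
  also have "(\<Prod>b\<in>Basis. exp (- ((x \<bullet> b)\<^sup>2 / (4 * s)))) = exp (- ((norm x)\<^sup>2 / (4 * s)))"
    by (simp add: exp_sum[symmetric] sum_negf sum_divide_distrib[symmetric]
        power2_norm_eq_inner[of x] euclidean_inner[of x x] power2_eq_square[of "inner x _", symmetric])
  also have "(\<Prod>b\<in>(Basis::'a set). 1 / sqrt (4 * pi * s)) = (4 * pi * s) powr (- (real DIM('a) / 2))"
  proof -
    have "1 / sqrt (4 * pi * s) = (4 * pi * s) powr (- (1/2))"
      using assms by (simp add: powr_half_sqrt[symmetric] powr_minus_divide)
    then show ?thesis
      using assms by (simp add: powr_realpow[symmetric] powr_powr)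
  qed
  finally show ?thesis by (simp add: heat_def)
qed

lemma nn_integral_heat:
  assumes "0 < s"
  shows "(\<integral>\<^sup>+(x::'a::euclidean_space). ennreal (heat DIM('a) s (norm x)) \<partial>lborel) = 1"
proof -
  have "(\<integral>\<^sup>+(x::'a). ennreal (heat DIM('a) s (norm x)) \<partial>lborel)
      = (\<integral>\<^sup>+(x::'a). (\<Prod>b\<in>Basis. ennreal (normal_density 0 (sqrt (2 * s)) (x \<bullet> b))) \<partial>lborel)"
    by (simp add: heat_as_product[OF assms] prod_ennreal)
  also have "\<dots> = (\<Prod>b\<in>(Basis::'a set). (\<integral>\<^sup>+t. ennreal (normal_density 0 (sqrt (2 * s)) t) \<partial>lborel))"
    by (rule nn_integral_lborel_prod) auto
  also have "(\<integral>\<^sup>+t. ennreal (normal_density 0 (sqrt (2 * s)) t) \<partial>lborel) = 1"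
    using assms by (subst nn_integral_eq_integral) auto
  finally show ?thesis by simp
qed

text \<open>The factor \<open>\<bar>x\<bar>\<^sup>2\<close> is absorbed by half of the exponent, which leaves the heat kernel at time \<open>2 s\<close>.\<close>
lemma nn_integral_heat_second_moment:
  "\<exists>C. \<forall>s>0. (\<integral>\<^sup>+(x::'a::euclidean_space). ennreal (min 1 ((norm x)\<^sup>2) * heat DIM('a) s (norm x)) \<partial>lborel)
      \<le> ennreal (C * min 1 s)"
proof -
  define C where "C = max 1 (8 * 2 powr (real DIM('a) / 2))"
  have "(\<integral>\<^sup>+(x::'a). ennreal (min 1 ((norm x)\<^sup>2) * heat DIM('a) s (norm x)) \<partial>lborel) \<le> ennreal (C * min 1 s)"
    if s: "0 < s" for s
  proof -
    have "(\<integral>\<^sup>+(x::'a). ennreal (min 1 ((norm x)\<^sup>2) * heat DIM('a) s (norm x)) \<partial>lborel)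
        \<le> (\<integral>\<^sup>+(x::'a). ennreal (heat DIM('a) s (norm x)) \<partial>lborel)"
      by (intro nn_integral_mono ennreal_leI mult_left_le_one_le) auto
    then have 1: "(\<integral>\<^sup>+(x::'a). ennreal (min 1 ((norm x)\<^sup>2) * heat DIM('a) s (norm x)) \<partial>lborel) \<le> ennreal 1"
      by (simp add: nn_integral_heat[OF s])
    have pt: "min 1 (r\<^sup>2) * heat DIM('a) s r \<le> C * s * heat DIM('a) (2 * s) r" for r
    proof -
      have "r\<^sup>2 / (8 * s) \<le> exp (r\<^sup>2 / (8 * s))"
        using exp_ge_add_one_self[of "r\<^sup>2 / (8 * s)"] by linarith
      then have "r\<^sup>2 / (8 * s) * exp (- (r\<^sup>2 / (4 * s))) \<le> exp (r\<^sup>2 / (8 * s)) * exp (- (r\<^sup>2 / (4 * s)))"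
        by (rule mult_right_mono) simp
      also have "\<dots> = exp (- (r\<^sup>2 / (8 * s)))"
        unfolding exp_add[symmetric] using s by (simp add: field_simps)
      finally have e: "r\<^sup>2 * exp (- (r\<^sup>2 / (4 * s))) \<le> 8 * s * exp (- (r\<^sup>2 / (8 * s)))"
        using s by (simp add: field_simps)
      have "min 1 (r\<^sup>2) * heat DIM('a) s r \<le> r\<^sup>2 * heat DIM('a) s r"
        by (intro mult_right_mono) auto
      also have "\<dots> = (4 * pi * s) powr (- (real DIM('a) / 2)) * (r\<^sup>2 * exp (- (r\<^sup>2 / (4 * s))))"
        by (simp add: heat_def)
      also have "\<dots> \<le> (4 * pi * s) powr (- (real DIM('a) / 2)) * (8 * s * exp (- (r\<^sup>2 / (8 * s))))"
        using e by (rule mult_left_mono) simp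
      also have "\<dots> = 8 * 2 powr (real DIM('a) / 2) * s * heat DIM('a) (2 * s) r"
      proof -
        have "(4 * pi * (2 * s)) powr (- (real DIM('a) / 2))
            = 2 powr (- (real DIM('a) / 2)) * (4 * pi * s) powr (- (real DIM('a) / 2))"
          by (metis mult.left_commute powr_mult)
        then show ?thesis by (simp add: heat_def powr_minus field_simps)
      qed
      also have "\<dots> \<le> C * s * heat DIM('a) (2 * s) r"
        using s by (intro mult_right_mono) (auto simp: C_def)
      finally show ?thesis .
    qed
    have "(\<integral>\<^sup>+(x::'a). ennreal (min 1 ((norm x)\<^sup>2) * heat DIM('a) s (norm x)) \<partial>lborel)
        \<le> (\<integral>\<^sup>+(x::'a). ennreal (C * s) * ennreal (heat DIM('a) (2 * s) (norm x)) \<partial>lborel)"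
      using pt s by (intro nn_integral_mono) (auto simp: ennreal_mult'[symmetric] C_def intro!: ennreal_leI)
    also have "\<dots> = ennreal (C * s)"
      using s by (subst nn_integral_cmult) (auto simp: nn_integral_heat)
    finally have 2: "(\<integral>\<^sup>+(x::'a). ennreal (min 1 ((norm x)\<^sup>2) * heat DIM('a) s (norm x)) \<partial>lborel) \<le> ennreal (C * s)" .
    have "ennreal 1 \<le> ennreal C" by (rule ennreal_leI) (simp add: C_def)
    with 1 2 show ?thesis by (cases "s \<le> 1") (auto simp del: ennreal_1)
  qed
  then show ?thesis by blast
qed

context cm_levy_density
begin

lemma heat_nu_integrable:
  assumes "0 < r"
  shows "integrable lborel (\<lambda>s. heat d s r * (indicator {0<..} s * \<nu> s))"
proof -
  from powr_exp_inverse_bound[of "real d / 2" "r\<^sup>2 / 4"] assms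
  obtain C where C: "\<And>s. 0 < s \<Longrightarrow> s powr (- (real d / 2)) * exp (- (r\<^sup>2 / 4 / s)) \<le> C * min 1 s"
    by auto
  define A where "A = (4 * pi) powr (- (real d / 2)) * C"
  have bound: "heat d s r \<le> A * min 1 s" if "0 < s" for s
    using mult_left_mono[OF C[OF that], of "(4 * pi) powr (- (real d / 2))"]
    by (simp add: heat_eq[OF that] A_def mult_ac)
  show ?thesis
  proof (rule Bochner_Integration.integrable_bound)
    show "integrable lborel (\<lambda>s. A * (min 1 s * (indicator {0<..} s * \<nu> s)))"
      by (intro integrable_mult_right nu_integrable)
    have "norm (heat d s r * (indicator {0<..} s * \<nu> s))
        \<le> norm (A * (min 1 s * (indicator {0<..} s * \<nu> s)))" for s
    proof (cases "0 < s")
      case True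
      then have "heat d s r * \<nu> s \<le> A * min 1 s * \<nu> s"
        using bound[OF True] nu_pos[OF True] by (intro mult_right_mono) auto
      moreover have "0 \<le> heat d s r * \<nu> s" using nu_pos[OF True] by simp
      ultimately show ?thesis using True by (simp add: mult_ac)
    qed simp
    then show "AE s in lborel. norm (heat d s r * (indicator {0<..} s * \<nu> s))
        \<le> norm (A * (min 1 s * (indicator {0<..} s * \<nu> s)))" by simp
  qed measurable
qed

lemma jump_kernel_eq: "jump_kernel d \<nu> r = (\<integral>s. heat d s r * (indicator {0<..} s * \<nu> s) \<partial>lborel)"
  unfolding jump_kernel_def set_lebesgue_integral_def heat_def by (simp add: mult_ac)

lemma heat_nu_nonneg: "0 \<le> heat d s r * (indicator {0<..} s * \<nu> s)"
  using nu_pos[of s] by (auto simp: indicator_def intro: mult_nonneg_nonneg)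

lemma ennreal_jump_kernel:
  assumes "0 < r"
  shows "ennreal (jump_kernel d \<nu> r) = (\<integral>\<^sup>+s. ennreal (heat d s r * (indicator {0<..} s * \<nu> s)) \<partial>lborel)"
  unfolding jump_kernel_eq
  by (rule nn_integral_eq_integral[symmetric])
     (use heat_nu_integrable[OF assms] heat_nu_nonneg in auto)

lemma jump_kernel_nonneg: "0 \<le> jump_kernel d \<nu> r"
  unfolding jump_kernel_eq by (rule integral_nonneg_AE) (simp add: heat_nu_nonneg)

lemma jump_kernel_antimono:
  assumes "0 < r" "r \<le> r'"
  shows "jump_kernel d \<nu> r' \<le> jump_kernel d \<nu> r"
  unfolding jump_kernel_eq
proof (rule integral_mono)
  show "heat d s r' * (indicator {0<..} s * \<nu> s) \<le> heat d s r * (indicator {0<..} s * \<nu> s)" for s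
    using assms nu_pos[of s]
    by (cases "0 < s") (auto intro!: mult_right_mono heat_antimono)
qed (use assms heat_nu_integrable in auto)

lemma jump_kernel_pos:
  assumes "0 < r"
  shows "0 < jump_kernel d \<nu> r"
proof (rule ccontr)
  assume "\<not> 0 < jump_kernel d \<nu> r"
  then have "(\<integral>s. heat d s r * (indicator {0<..} s * \<nu> s) \<partial>lborel) = 0"
    using jump_kernel_nonneg[of d r] by (simp add: jump_kernel_eq)
  then have "AE s in lborel. heat d s r * (indicator {0<..} s * \<nu> s) = 0"
    using integral_nonneg_eq_0_iff_AE[OF heat_nu_integrable[OF assms]] heat_nu_nonneg by auto
  then have "AE s in lborel. s \<notin> {0<..<1::real}"
  proof eventually_elim
    case (elim s)
    then show ?case using nu_pos[of s] heat_pos[of s d r] by (cases "0 < s") auto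
  qed
  then have "emeasure lborel {0<..<1::real} = 0"
    by (subst (asm) AE_iff_measurable[of "{0<..<1}"]) auto
  then show False by simp
qed

lemma jump_kernel_measurable [measurable]:
  "(\<lambda>x. jump_kernel d \<nu> (f x)) \<in> borel_measurable M" if [measurable]: "f \<in> borel_measurable M"
  unfolding jump_kernel_eq by measurable

text \<open>The jump kernel is the density of a Levy measure: integrate the second moments of the heat
kernels against \<open>\<nu>\<close>.\<close>
lemma integrable_jump_kernel:
  "integrable lborel (\<lambda>h::'a::euclidean_space. min 1 ((norm h)\<^sup>2) * jump_kernel DIM('a) \<nu> (norm h))"
proof (rule integrableI_bounded)
  obtain C where C: "\<And>s. 0 < s \<Longrightarrow>
      (\<integral>\<^sup>+(x::'a). ennreal (min 1 ((norm x)\<^sup>2) * heat DIM('a) s (norm x)) \<partial>lborel) \<le> ennreal (C * min 1 s)"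
    using nn_integral_heat_second_moment by blast
  let ?nu = "\<lambda>s. indicator {0<..} s * \<nu> s"
  have nu0: "0 \<le> ?nu s" for s using nu_pos[of s] by (auto simp: indicator_def)
  have "(\<integral>\<^sup>+(h::'a). ennreal (norm (min 1 ((norm h)\<^sup>2) * jump_kernel DIM('a) \<nu> (norm h))) \<partial>lborel)
      = (\<integral>\<^sup>+(h::'a). \<integral>\<^sup>+s. ennreal (min 1 ((norm h)\<^sup>2) * heat DIM('a) s (norm h)) * ennreal (?nu s) \<partial>lborel \<partial>lborel)"
  proof (rule nn_integral_cong_AE)
    show "AE h::'a in lborel. ennreal (norm (min 1 ((norm h)\<^sup>2) * jump_kernel DIM('a) \<nu> (norm h)))
        = (\<integral>\<^sup>+s. ennreal (min 1 ((norm h)\<^sup>2) * heat DIM('a) s (norm h)) * ennreal (?nu s) \<partial>lborel)"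
      using AE_lborel_singleton[of 0]
    proof eventually_elim
      case (elim h)
      have "ennreal (norm (min 1 ((norm h)\<^sup>2) * jump_kernel DIM('a) \<nu> (norm h)))
          = ennreal (min 1 ((norm h)\<^sup>2)) * ennreal (jump_kernel DIM('a) \<nu> (norm h))"
        using jump_kernel_nonneg by (simp add: ennreal_mult' abs_mult)
      also have "\<dots> = (\<integral>\<^sup>+s. ennreal (min 1 ((norm h)\<^sup>2)) * ennreal (heat DIM('a) s (norm h) * ?nu s) \<partial>lborel)"
        using elim by (subst ennreal_jump_kernel) (auto intro!: nn_integral_cmult[symmetric])
      finally show ?case
        using nu0 by (simp add: ennreal_mult' mult.assoc)
    qed
  qed
  also have "\<dots> = (\<integral>\<^sup>+s. \<integral>\<^sup>+(h::'a). ennreal (min 1 ((norm h)\<^sup>2) * heat DIM('a) s (norm h)) * ennreal (?nu s) \<partial>lborel \<partial>lborel)"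
    by (rule lborel_pair.Fubini') measurable
  also have "\<dots> = (\<integral>\<^sup>+s. (\<integral>\<^sup>+(h::'a). ennreal (min 1 ((norm h)\<^sup>2) * heat DIM('a) s (norm h)) \<partial>lborel) * ennreal (?nu s) \<partial>lborel)"
    by (intro nn_integral_cong nn_integral_multc) measurable
  also have "\<dots> \<le> (\<integral>\<^sup>+s. ennreal (C * (min 1 s * ?nu s)) \<partial>lborel)"
  proof (intro nn_integral_mono)
    fix s :: real
    show "(\<integral>\<^sup>+(h::'a). ennreal (min 1 ((norm h)\<^sup>2) * heat DIM('a) s (norm h)) \<partial>lborel) * ennreal (?nu s)
        \<le> ennreal (C * (min 1 s * ?nu s))"
    proof (cases "0 < s")
      case True
      have "(\<integral>\<^sup>+(h::'a). ennreal (min 1 ((norm h)\<^sup>2) * heat DIM('a) s (norm h)) \<partial>lborel) * ennreal (?nu s)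
          \<le> ennreal (C * min 1 s) * ennreal (?nu s)"
        by (intro mult_right_mono C True) auto
      also have "\<dots> = ennreal (C * (min 1 s * ?nu s))"
        using nu0[of s] by (subst ennreal_mult''[symmetric]) (auto simp: mult_ac)
      finally show ?thesis .
    qed simp
  qed
  also have "\<dots> < \<infinity>"
    using integrable_mult_right[OF nu_integrable, of C]
    unfolding real_integrable_def by (simp add: less_top)
  finally show "(\<integral>\<^sup>+(h::'a). ennreal (norm (min 1 ((norm h)\<^sup>2) * jump_kernel DIM('a) \<nu> (norm h))) \<partial>lborel) < \<infinity>" .
qed measurable

text \<open>The pointwise comparison of radius \<open>r\<close> with radius \<open>r + 1\<close> in the mixture of heat kernels. For large
times the heat kernel itself changes by a bounded factor; for \<open>s (2 r + 1) \<le> r\<^sup>2\<close>, the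
exponential factor does not decrease when \<open>s\<close> and \<open>r\<close> both grow by \<open>1\<close>, and for \<open>s \<ge> 1\<close> the other factors
lose at most a constant. For \<open>s < 1\<close> the singularity of \<open>\<nu>\<close> at \<open>0\<close> is absorbed by the surplus \<open>1 / (8 s)\<close> in the exponent, which is
available since \<open>r \<ge> 3\<close>.\<close>
lemma heat_nu_shift:
  "\<exists>C. \<forall>r\<ge>3. \<forall>s>0. heat d s r * \<nu> s \<le> C * (heat d s (r + 1) * \<nu> s + heat d (s + 1) (r + 1) * \<nu> (s + 1))"
proof -
  define a where "a = real d / 2"
  obtain K where K: "0 < K" "\<And>s. 0 < s \<Longrightarrow> s \<le> 1 \<Longrightarrow> \<nu> s \<le> K / s\<^sup>2"
    using nu_quadratic_bound by auto
  obtain C where C: "0 < C"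
      "\<And>s. 0 < s \<Longrightarrow> s powr (- (a + 2)) * exp (- (1 / 8 / s)) \<le> C * min 1 s"
    using powr_exp_inverse_bound[of "a + 2" "1/8"] by (auto simp: a_def)
  define C1 where "C1 = exp (9/4 :: real)"
  define C2 where "C2 = 2 powr a * (\<nu> 1 / \<nu> 3)"
  define C3 where "C3 = K * C * 2 powr a / \<nu> 2"
  have Cpos: "0 < C1" "0 < C2" "0 < C3"
    using nu_pos[of 1] nu_pos[of 2] nu_pos[of 3] K C by (simp_all add: C1_def C2_def C3_def)
  let ?e = "\<lambda>s r. exp (- (r\<^sup>2 / (4 * s)))"
  have "s powr (- a) * ?e s r * \<nu> s
      \<le> (C1 + C2 + C3) * (s powr (- a) * ?e s (r + 1) * \<nu> s + (s + 1) powr (- a) * ?e (s + 1) (r + 1) * \<nu> (s + 1))"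
    if r: "3 \<le> r" and s: "0 < s" for r s
  proof -
    have nu: "0 < \<nu> s" "0 < \<nu> (s + 1)" using s nu_pos by auto
    define X where "X = s powr (- a) * ?e s (r + 1) * \<nu> s"
    define Y where "Y = (s + 1) powr (- a) * ?e (s + 1) (r + 1) * \<nu> (s + 1)"
    have XY: "0 \<le> X" "0 \<le> Y" using nu by (simp_all add: X_def Y_def)
    consider "r\<^sup>2 \<le> s * (2 * r + 1)" | "s * (2 * r + 1) \<le> r\<^sup>2" "1 \<le> s" | "s < 1" by linarith
    then have "s powr (- a) * ?e s r * \<nu> s \<le> C1 * X \<or> s powr (- a) * ?e s r * \<nu> s \<le> C2 * Y
        \<or> s powr (- a) * ?e s r * \<nu> s \<le> C3 * Y"
    proof cases
      case 1
      have "(2 * r + 1) * r\<^sup>2 \<le> (2 * r + 1) * (s * (2 * r + 1))"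
        using 1 r by (intro mult_left_mono) auto
      also have "\<dots> = s * (2 * r + 1)\<^sup>2" by (simp add: power2_eq_square)
      also have "\<dots> \<le> s * (3 * r)\<^sup>2" using r s by (intro mult_left_mono power_mono) auto
      finally have "2 * r + 1 \<le> 9 * s" using r by (simp add: power_mult_distrib)
      then have "(2 * r + 1) / (4 * s) \<le> 9 / 4" using s by (simp add: field_simps)
      moreover have "(r + 1)\<^sup>2 / (4 * s) - r\<^sup>2 / (4 * s) = (2 * r + 1) / (4 * s)"
        by (simp add: diff_divide_distrib[symmetric] power2_eq_square algebra_simps)
      ultimately have "(r + 1)\<^sup>2 / (4 * s) - r\<^sup>2 / (4 * s) \<le> 9 / 4" by simp
      then have "?e s r \<le> C1 * ?e s (r + 1)"
        by (simp add: C1_def exp_add[symmetric])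
      then have "s powr (- a) * ?e s r * \<nu> s \<le> s powr (- a) * (C1 * ?e s (r + 1)) * \<nu> s"
        using nu by (intro mult_right_mono mult_left_mono) auto
      then show ?thesis by (simp add: X_def mult_ac)
    next
      case 2
      have "(r + 1)\<^sup>2 / (4 * (s + 1)) \<le> r\<^sup>2 / (4 * s)"
        using 2 by (simp add: field_simps power2_eq_square)
      then have e: "?e s r \<le> ?e (s + 1) (r + 1)" by simp
      have "(2 * s) powr (- a) \<le> (s + 1) powr (- a)"
        using 2 s by (intro powr_mono2') (auto simp: a_def)
      then have p: "s powr (- a) \<le> 2 powr a * (s + 1) powr (- a)"
        using s by (simp add: powr_mult powr_minus field_simps)
      have n: "\<nu> s \<le> \<nu> 1 / \<nu> 3 * \<nu> (s + 1)"
        using completely_monotone_shift[OF cm nu_pos] 2 by blast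
      have "s powr (- a) * ?e s r * \<nu> s
          \<le> (2 powr a * (s + 1) powr (- a)) * ?e (s + 1) (r + 1) * (\<nu> 1 / \<nu> 3 * \<nu> (s + 1))"
        using e p n nu by (intro mult_mono) auto
      then show ?thesis by (simp add: C2_def Y_def mult_ac)
    next
      case 3
      have "s * (2 * r + 1) \<le> 1 * (2 * r + 1)" using 3 r by (intro mult_right_mono) auto
      then have "s * (2 * r + 1) + 1 \<le> 9 + 6 * (r - 3)" using r by argo
      also have "\<dots> \<le> r\<^sup>2"
        using zero_le_power2[of "r - 3"] by (simp add: power2_eq_square algebra_simps)
      finally have "s * (2 * r + 1) + 1 \<le> r\<^sup>2" .
      then have "1 \<le> r\<^sup>2 - s * (2 * r + 1)" by (simp only: le_diff_eq add.commute)
      moreover have "(1 / 2) * (s + 1) \<le> 1" using 3 by simp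
      ultimately have "(1 / 2) * (s + 1) \<le> r\<^sup>2 - s * (2 * r + 1)" by (rule order_trans[rotated])
      then have "(1 / 2) * (s + 1) / (4 * s * (s + 1)) \<le> (r\<^sup>2 - s * (2 * r + 1)) / (4 * s * (s + 1))"
        using s by (intro divide_right_mono) auto
      also have "\<dots> = (4 * (r\<^sup>2 - s * (2 * r + 1))) / (4 * (4 * s * (s + 1)))"
        by (rule mult_divide_mult_cancel_left[symmetric]) simp
      also have "\<dots> = (r\<^sup>2 * (4 * (s + 1)) - (r + 1)\<^sup>2 * (4 * s)) / ((4 * s) * (4 * (s + 1)))"
        by (rule arg_cong2[where f="(/)"]) (simp_all add: power2_eq_square algebra_simps)
      also have "\<dots> = r\<^sup>2 / (4 * s) - (r + 1)\<^sup>2 / (4 * (s + 1))"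
        using s by (intro diff_frac_eq[symmetric]) auto
      also have "(1 / 2) * (s + 1) / (4 * s * (s + 1)) = (1 / 2) / (4 * s)"
        by (rule mult_divide_mult_cancel_right) (use s in simp)
      also have "\<dots> = 1 / 8 / s" by simp
      finally have "1 / 8 / s \<le> r\<^sup>2 / (4 * s) - (r + 1)\<^sup>2 / (4 * (s + 1))" .
      then have e: "?e s r \<le> exp (- (1 / 8 / s)) * ?e (s + 1) (r + 1)"
        by (simp add: exp_add[symmetric])
      have "s powr (- a) * ?e s r * \<nu> s \<le> s powr (- a) * (exp (- (1 / 8 / s)) * ?e (s + 1) (r + 1)) * (K / s\<^sup>2)"
        using e K(2)[of s] 3 s nu by (intro mult_mono) auto
      also have "\<dots> = K * (s powr (- (a + 2)) * exp (- (1 / 8 / s))) * ?e (s + 1) (r + 1)"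
      proof -
        have "s powr (- (a + 2)) = s powr (- a - 2)" by (simp add: algebra_simps)
        also have "\<dots> = s powr (- a) / s powr 2" by (rule powr_diff)
        also have "s powr 2 = s\<^sup>2" using s powr_realpow[of s 2] by simp
        finally show ?thesis by simp
      qed
      also have "\<dots> \<le> K * C * ?e (s + 1) (r + 1)"
      proof -
        have "C * min 1 s \<le> C * 1" using C(1) by (intro mult_left_mono) auto
        with C(2)[OF s] have "s powr (- (a + 2)) * exp (- (1 / 8 / s)) \<le> C" by linarith
        then show ?thesis using K(1) by (intro mult_right_mono mult_left_mono) auto
      qed
      also have "\<dots> \<le> K * C * ?e (s + 1) (r + 1) * ((2 powr a * (s + 1) powr (- a)) * (\<nu> (s + 1) / \<nu> 2))"
      proof -
        have "2 powr (- a) \<le> (s + 1) powr (- a)"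
          using 3 s by (intro powr_mono2') (auto simp: a_def)
        then have "1 \<le> 2 powr a * (s + 1) powr (- a)" by (simp add: powr_minus field_simps)
        moreover have "1 \<le> \<nu> (s + 1) / \<nu> 2" using nu_antimono[of "s + 1" 2] nu_pos[of 2] 3 s by simp
        ultimately have "1 * 1 \<le> (2 powr a * (s + 1) powr (- a)) * (\<nu> (s + 1) / \<nu> 2)"
          by (intro mult_mono) auto
        from mult_left_mono[OF this, of "K * C * ?e (s + 1) (r + 1)"] show ?thesis
          using K(1) C(1) by simp
      qed
      also have "\<dots> = C3 * Y" by (simp add: C3_def Y_def mult_ac)
      finally show ?thesis by simp
    qed
    moreover have "C1 * X \<le> (C1 + C2 + C3) * (X + Y)" "C2 * Y \<le> (C1 + C2 + C3) * (X + Y)"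
      "C3 * Y \<le> (C1 + C2 + C3) * (X + Y)"
      using Cpos XY by (intro mult_mono; simp)+
    ultimately show ?thesis unfolding X_def[symmetric] Y_def[symmetric] by linarith
  qed
  note pointwise = this
  have heat: "heat d s r = (4 * pi) powr (- a) * (s powr (- a) * ?e s r)" if "0 < s" for r s
    using that by (simp add: heat_def powr_mult a_def)
  have "heat d s r * \<nu> s \<le> (C1 + C2 + C3) * (heat d s (r + 1) * \<nu> s + heat d (s + 1) (r + 1) * \<nu> (s + 1))"
    if "3 \<le> r" "0 < s" for r s
  proof -
    have "heat d s r * \<nu> s = (4 * pi) powr (- a) * (s powr (- a) * ?e s r * \<nu> s)"
      using that by (simp add: heat)
    also have "\<dots> \<le> (4 * pi) powr (- a) * ((C1 + C2 + C3) * (s powr (- a) * ?e s (r + 1) * \<nu> s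
        + (s + 1) powr (- a) * ?e (s + 1) (r + 1) * \<nu> (s + 1)))"
      using pointwise[OF that] by (intro mult_left_mono) auto
    also have "\<dots> = (C1 + C2 + C3) * (((4 * pi) powr (- a) * (s powr (- a) * ?e s (r + 1))) * \<nu> s
        + ((4 * pi) powr (- a) * ((s + 1) powr (- a) * ?e (s + 1) (r + 1))) * \<nu> (s + 1))"
      by (simp only: distrib_left mult_ac)
    finally show ?thesis using that by (simp only: heat add_pos_pos zero_less_one)
  qed
  then show ?thesis by blast
qed

text \<open>Integration of the previous bound; in the second term the time is substituted back. This is the
regularity of the kernel at infinity that makes \<open>L \<xi>\<close> decay like the kernel itself.\<close>
lemma jump_kernel_shift: "\<exists>C. \<forall>r\<ge>3. jump_kernel d \<nu> r \<le> C * jump_kernel d \<nu> (r + 1)"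
proof -
  obtain C where C: "\<And>r s. 3 \<le> r \<Longrightarrow> 0 < s \<Longrightarrow>
      heat d s r * \<nu> s \<le> C * (heat d s (r + 1) * \<nu> s + heat d (s + 1) (r + 1) * \<nu> (s + 1))"
    using heat_nu_shift by blast
  have "jump_kernel d \<nu> r \<le> (2 * C) * jump_kernel d \<nu> (r + 1)" if r: "3 \<le> r" for r
  proof -
    let ?g = "\<lambda>s. heat d s (r + 1) * (indicator {0<..} s * \<nu> s)"
    let ?h = "\<lambda>s. heat d (s + 1) (r + 1) * (indicator {1<..} (s + 1) * \<nu> (s + 1))"
    have g: "integrable lborel ?g" using heat_nu_integrable r by simp
    have "integrable lborel (\<lambda>s. indicator {1<..} s * ?g s)"
      using integrable_mult_indicator[OF _ g, of "{1<..}"] by simp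
    then have g1: "integrable lborel (\<lambda>s. heat d s (r + 1) * (indicator {1<..} s * \<nu> s))"
      by (rule back_subst[of "integrable lborel"]) (auto simp: indicator_def fun_eq_iff)
    have h: "integrable lborel ?h"
      using lborel_integrable_real_affine[OF g1, of 1 1] by (simp add: add.commute)
    have "(\<integral>s. ?h s \<partial>lborel) = (\<integral>s. heat d s (r + 1) * (indicator {1<..} s * \<nu> s) \<partial>lborel)"
      using lborel_integral_real_affine[of 1 "\<lambda>s. heat d s (r + 1) * (indicator {1<..} s * \<nu> s)" 1]
      by (simp add: add.commute)
    also have "\<dots> \<le> (\<integral>s. ?g s \<partial>lborel)"
    proof (rule integral_mono[OF g1 g])
      show "heat d s (r + 1) * (indicator {1<..} s * \<nu> s) \<le> ?g s" for s
        using nu_pos[of s] by (auto simp: indicator_def)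
    qed
    finally have hg: "(\<integral>s. ?h s \<partial>lborel) \<le> (\<integral>s. ?g s \<partial>lborel)" .
    have "0 < heat d 1 3 * \<nu> 1" using nu_pos[of 1] heat_pos[of 1] by simp
    also have "\<dots> \<le> C * (heat d 1 (3 + 1) * \<nu> 1 + heat d (1 + 1) (3 + 1) * \<nu> (1 + 1))"
      by (rule C) auto
    finally have "0 < C * (heat d 1 (3 + 1) * \<nu> 1 + heat d (1 + 1) (3 + 1) * \<nu> (1 + 1))" .
    moreover have "0 < heat d 1 (3 + 1) * \<nu> 1 + heat d (1 + 1) (3 + 1) * \<nu> (1 + 1)"
      by (intro add_pos_pos mult_pos_pos heat_pos nu_pos) auto
    ultimately have "0 < C" by (rule zero_less_mult_pos2)
    then have "0 \<le> C" by simp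
    have "jump_kernel d \<nu> r \<le> (\<integral>s. C * (?g s + ?h s) \<partial>lborel)"
      unfolding jump_kernel_eq
    proof (rule integral_mono)
      show "heat d s r * (indicator {0<..} s * \<nu> s) \<le> C * (?g s + ?h s)" for s
        using C[OF r, of s] by (auto simp: indicator_def)
    qed (use g h heat_nu_integrable r in auto)
    also have "\<dots> = C * ((\<integral>s. ?g s \<partial>lborel) + (\<integral>s. ?h s \<partial>lborel))"
      using g h by simp
    also have "\<dots> \<le> C * ((\<integral>s. ?g s \<partial>lborel) + (\<integral>s. ?g s \<partial>lborel))"
      using hg \<open>0 \<le> C\<close> by (intro mult_left_mono) auto
    finally show ?thesis by (simp add: jump_kernel_eq)
  qed
  then show ?thesis by blast
qed

end

section \<open>Smooth bump functions\<close>

text \<open>The functions \<open>t powr (- n) * exp (- 1 / t)\<close> for \<open>t > 0\<close>, extended by \<open>0\<close>. Their linear span is closed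
under differentiation.\<close>
definition flat :: "nat \<Rightarrow> real \<Rightarrow> real" where
  "flat n t = (if t \<le> 0 then 0 else inverse t ^ n * exp (- inverse t))"

lemma flat_nonneg [simp]: "0 \<le> flat n t"
  by (simp add: flat_def)

lemma flat_bound: "\<exists>C>0. \<forall>t. flat n t \<le> C \<and> flat n t \<le> C * \<bar>t\<bar>"
proof -
  obtain C where C: "0 < C" "\<And>s. 0 < s \<Longrightarrow> s powr (- real n) * exp (- (1 / s)) \<le> C * min 1 s"
    using powr_exp_inverse_bound[of "real n" 1] by auto
  have "flat n t \<le> C \<and> flat n t \<le> C * \<bar>t\<bar>" for t
  proof (cases "t \<le> 0")
    case True
    then have "flat n t = 0" by (simp add: flat_def)
    then show ?thesis using C(1) by simp
  next
    case False
    then have "flat n t = t powr (- real n) * exp (- (1 / t))"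
      by (simp add: flat_def powr_minus powr_realpow power_inverse divide_inverse)
    also have "\<dots> \<le> C * min 1 t" using C(2) False by simp
    finally have "flat n t \<le> C * min 1 t" .
    moreover have "C * min 1 t \<le> C * 1" "C * min 1 t \<le> C * \<bar>t\<bar>"
      using C(1) False by (intro mult_left_mono; simp)+
    ultimately show ?thesis by linarith
  qed
  with C(1) show ?thesis by blast
qed

lemma flat_has_derivative:
  "(flat n has_real_derivative flat (n + 2) t - real n * flat (n + 1) t) (at t)"
proof -
  consider "t < 0" | "t = 0" | "0 < t" by linarith
  then show ?thesis
  proof cases
    case 1
    have "((\<lambda>x. 0) has_real_derivative 0) (at t)" by simp
    then have "(flat n has_real_derivative 0) (at t)"
      by (rule has_field_derivative_transform_within_open[of _ _ _ "{..<0}"])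
         (use 1 in \<open>auto simp: flat_def\<close>)
    then show ?thesis using 1 by (simp add: flat_def)
  next
    case 2
    obtain C where C: "\<And>t. flat (n + 1) t \<le> C * \<bar>t\<bar>" using flat_bound[of "n + 1"] by blast
    \<comment> \<open>The difference quotient of \<open>flat n\<close> at \<open>0\<close> is \<open>flat (n + 1)\<close>.\<close>
    have "((\<lambda>h. flat n h / h) \<longlongrightarrow> 0) (at 0)"
    proof (rule Lim_null_comparison)
      have "norm (flat n h / h) \<le> C * \<bar>h\<bar>" for h
      proof -
        have "flat n h / h = flat (n + 1) h" by (simp add: flat_def field_simps)
        then show ?thesis using C[of h] by simp
      qed
      then show "\<forall>\<^sub>F h in at 0. norm (flat n h / h) \<le> C * \<bar>h\<bar>" by simp
      have "((\<lambda>h. C * \<bar>h\<bar>) \<longlongrightarrow> C * \<bar>0\<bar>) (at 0)" by (intro tendsto_intros)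
      then show "((\<lambda>h. C * \<bar>h\<bar>) \<longlongrightarrow> 0) (at 0)" by simp
    qed
    then show ?thesis using 2 by (simp add: DERIV_def flat_def)
  next
    case 3
    have inv: "(inverse has_real_derivative - (inverse t)\<^sup>2) (at t)"
      using DERIV_inverse[of t] 3 by (simp add: numeral_2_eq_2)
    have "((\<lambda>x. exp (- inverse x)) has_real_derivative exp (- inverse t) * (inverse t)\<^sup>2) (at t)"
      using DERIV_fun_exp[OF DERIV_minus[OF inv]] by simp
    from DERIV_mult[OF DERIV_power[OF inv, of n] this]
    have "((\<lambda>x. inverse x ^ n * exp (- inverse x)) has_real_derivative
        flat (n + 2) t - real n * flat (n + 1) t) (at t)"
      by (rule DERIV_cong)
         (use 3 in \<open>cases n; simp add: flat_def algebra_simps power2_eq_square\<close>)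
    then show ?thesis
      by (rule has_field_derivative_transform_within_open[of _ _ _ "{0<..}"])
         (use 3 in \<open>auto simp: flat_def\<close>)
  qed
qed

lemma second_difference_bound:
  fixes g g' g'' :: "real \<Rightarrow> real"
  assumes d1: "\<And>t. (g has_real_derivative g' t) (at t)"
    and d2: "\<And>t. (g' has_real_derivative g'' t) (at t)"
    and M: "\<And>t. \<bar>g'' t\<bar> \<le> M"
  shows "\<bar>g 1 + g (-1) - 2 * g 0\<bar> \<le> 2 * M"
proof -
  have "((\<lambda>t. g t + g (- t)) has_real_derivative g' t - g' (- t)) (at t)" for t
  proof -
    have "((\<lambda>t. g (- t)) has_real_derivative g' (- t) * (-1)) (at t)"
      by (rule DERIV_chain2[of g, OF d1]) (auto intro!: derivative_eq_intros)
    from DERIV_add[OF d1 this] show ?thesis by simp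
  qed
  then obtain \<tau> where \<tau>: "0 < \<tau>" "\<tau> < 1"
    and e1: "(g 1 + g (-1)) - (g 0 + g (- 0)) = (1 - 0) * (g' \<tau> - g' (- \<tau>))"
    using MVT2[of 0 1 "\<lambda>t. g t + g (- t)" "\<lambda>t. g' t - g' (- t)"] by auto
  obtain \<sigma> where e2: "g' \<tau> - g' (- \<tau>) = (\<tau> - - \<tau>) * g'' \<sigma>"
    using MVT2[of "- \<tau>" \<tau> g' g''] \<tau> d2 by auto
  have "\<bar>g 1 + g (-1) - 2 * g 0\<bar> = 2 * (\<tau> * \<bar>g'' \<sigma>\<bar>)"
    using e1 e2 \<tau> by (simp add: abs_mult)
  also have "\<tau> * \<bar>g'' \<sigma>\<bar> \<le> 1 * M"
    using \<tau> M[of \<sigma>] by (intro mult_mono) auto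
  finally show ?thesis by simp
qed

text \<open>A smooth radial bump around the origin, positive exactly on the open ball of radius \<open>r\<close>
(for \<open>r > 0\<close>).\<close>
definition bump :: "real \<Rightarrow> 'a::euclidean_space \<Rightarrow> real" where
  "bump r x = flat 0 (r\<^sup>2 - (norm x)\<^sup>2)"

lemma bump_nonneg [simp]: "0 \<le> bump r x"
  by (simp add: bump_def)

lemma bump_pos: "norm x < r \<Longrightarrow> 0 < bump r x"
  using power_strict_mono[of "norm x" r 2] by (simp add: bump_def flat_def)

lemma bump_eq_0: "0 \<le> r \<Longrightarrow> r \<le> norm x \<Longrightarrow> bump r x = 0"
  by (simp add: bump_def flat_def power_mono)

lemma bump_bounded: "\<exists>C>0. \<forall>x. bump r x \<le> C"
  using flat_bound[of 0] unfolding bump_def by blast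

text \<open>An algebra of functions that contains the bump with centre \<open>c\<close> and is closed under directional
derivatives; every member is therefore differentiable to all orders.\<close>
inductive bump_expr :: "'a::euclidean_space \<Rightarrow> real \<Rightarrow> ('a \<Rightarrow> real) \<Rightarrow> bool" for c r where
  const: "bump_expr c r (\<lambda>x. a)"
| linear: "bump_expr c r (\<lambda>x. (x - c) \<bullet> v)"
| flat: "bump_expr c r (\<lambda>x. flat n (r\<^sup>2 - (norm (x - c))\<^sup>2))"
| add: "bump_expr c r f \<Longrightarrow> bump_expr c r g \<Longrightarrow> bump_expr c r (\<lambda>x. f x + g x)"
| mult: "bump_expr c r f \<Longrightarrow> bump_expr c r g \<Longrightarrow> bump_expr c r (\<lambda>x. f x * g x)"

lemma bump_expr_derivative:
  "bump_expr c r f \<Longrightarrow>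
    \<exists>D. (\<forall>x. (f has_derivative D x) (at x)) \<and> (\<forall>v. bump_expr c r (\<lambda>x. D x v))"
proof (induction rule: bump_expr.induct)
  case (const a)
  show ?case by (intro exI[of _ "\<lambda>x v. 0"]) (auto intro: bump_expr.intros)
next
  case (linear v)
  show ?case
    by (intro exI[of _ "\<lambda>x w. w \<bullet> v"]) (auto intro!: derivative_eq_intros bump_expr.intros)
next
  case (flat n)
  let ?q = "\<lambda>x. r\<^sup>2 - (norm (x - c))\<^sup>2"
  let ?D = "\<lambda>x v. (flat (n + 2) (?q x) + - real n * flat (n + 1) (?q x)) * (- 2 * ((x - c) \<bullet> v))"
  have "((\<lambda>x. flat n (?q x)) has_derivative ?D x) (at x)" for x
  proof -
    have "(?q has_derivative (\<lambda>v. - 2 * ((x - c) \<bullet> v))) (at x)"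
      unfolding power2_norm_eq_inner
      by (auto intro!: derivative_eq_intros simp: inner_commute)
    moreover have "(flat n has_derivative (*) (flat (n + 2) (?q x) - real n * flat (n + 1) (?q x))) (at (?q x))"
      using flat_has_derivative by (simp add: has_field_derivative_def)
    ultimately show ?thesis by (auto dest: has_derivative_compose)
  qed
  moreover have "bump_expr c r (\<lambda>x. ?D x v)" for v by (intro bump_expr.intros)
  ultimately show ?case by (intro exI[of _ ?D]) blast
next
  case (add f g)
  then obtain D D' where "\<forall>x. (f has_derivative D x) (at x)" "\<forall>v. bump_expr c r (\<lambda>x. D x v)"
    "\<forall>x. (g has_derivative D' x) (at x)" "\<forall>v. bump_expr c r (\<lambda>x. D' x v)" by blast
  then show ?case
    by (intro exI[of _ "\<lambda>x v. D x v + D' x v"]) (auto intro!: derivative_eq_intros bump_expr.intros)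
next
  case (mult f g)
  then obtain D D' where "\<forall>x. (f has_derivative D x) (at x)" "\<forall>v. bump_expr c r (\<lambda>x. D x v)"
    "\<forall>x. (g has_derivative D' x) (at x)" "\<forall>v. bump_expr c r (\<lambda>x. D' x v)" by blast
  with mult.hyps show ?case
    by (intro exI[of _ "\<lambda>x v. f x * D' x v + D x v * g x"]) (auto intro!: derivative_eq_intros bump_expr.intros)
qed

lemma bump_expr_Ck: "bump_expr c r f \<Longrightarrow> Ck k f"
proof (induction k arbitrary: f)
  case 0
  from bump_expr_derivative[OF 0] show ?case
    by (auto intro!: continuous_at_imp_continuous_on dest: has_derivative_continuous)
next
  case (Suc k)
  from bump_expr_derivative[OF Suc.prems] obtain D
    where D: "\<And>x. (f has_derivative D x) (at x)" "\<And>v. bump_expr c r (\<lambda>x. D x v)" by blast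
  have "frechet_derivative f (at x) = D x" for x
    using frechet_derivative_at[OF D(1)] by simp
  with D Suc.IH show ?case by (auto simp: differentiable_def)
qed

lemma bump_shift_Ck: "Ck k (\<lambda>x. bump r (x - c))"
  unfolding bump_def by (rule bump_expr_Ck[OF bump_expr.flat])

lemma bump_continuous: "continuous_on UNIV (bump r)"
  using bump_shift_Ck[of 0 r 0] by simp

lemma bump_measurable [measurable]: "bump r \<in> borel_measurable borel"
  by (rule borel_measurable_continuous_onI[OF bump_continuous])

lemma bump_shift_test_function:
  assumes "0 \<le> r" "cball c r \<subseteq> \<Omega>"
  shows "(\<lambda>x. bump r (x - c)) \<in> test_functions \<Omega>"
proof -
  have "{x. bump r (x - c) \<noteq> 0} \<subseteq> cball c r"
  proof
    fix x assume "x \<in> {x. bump r (x - c) \<noteq> 0}"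
    then have "\<not> r \<le> norm (x - c)" using bump_eq_0[OF assms(1)] by blast
    then show "x \<in> cball c r" by (simp add: dist_norm norm_minus_commute)
  qed
  then have *: "closure {x. bump r (x - c) \<noteq> 0} \<subseteq> cball c r"
    by (rule closure_minimal) simp
  then have "bounded (closure {x. bump r (x - c) \<noteq> 0})"
    by (rule bounded_subset[OF bounded_cball])
  then have "compact (closure {x. bump r (x - c) \<noteq> 0})"
    by (simp add: compact_eq_bounded_closed)
  with * assms show ?thesis by (auto simp: test_functions_def bump_shift_Ck)
qed

text \<open>Along a line through \<open>x\<close> in direction \<open>h\<close>, the second derivative of the bump is of order \<open>\<bar>h\<bar>\<^sup>2\<close>.\<close>
lemma bump_second_difference:
  assumes "0 \<le> r"
  shows "\<exists>A. \<forall>(x::'a::euclidean_space) h.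
    \<bar>bump r (x + h) + bump r (x - h) - 2 * bump r x\<bar> \<le> A * min 1 ((norm h)\<^sup>2)"
proof -
  obtain C0 where C0: "0 < C0" "\<And>x::'a. bump r x \<le> C0" using bump_bounded by blast
  obtain C2 where C2: "0 < C2" "\<And>t. flat 2 t \<le> C2" using flat_bound[of 2] by blast
  obtain C3 where C3: "0 < C3" "\<And>t. flat 3 t \<le> C3" using flat_bound[of 3] by blast
  obtain C4 where C4: "0 < C4" "\<And>t. flat 4 t \<le> C4" using flat_bound[of 4] by blast
  define N where "N = (C4 + 2 * C3) * (4 * r\<^sup>2) + 2 * C2"
  have N: "0 \<le> N" using C2 C3 C4 by (simp add: N_def)
  have quad: "\<bar>bump r (x + h) + bump r (x - h) - 2 * bump r x\<bar> \<le> 2 * (N * (norm h)\<^sup>2)" for x h :: 'a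
  proof -
    define q where "q t = r\<^sup>2 - (x + t *\<^sub>R h) \<bullet> (x + t *\<^sub>R h)" for t
    define p where "p t = - 2 * ((x + t *\<^sub>R h) \<bullet> h)" for t
    have q: "(q has_real_derivative p t) (at t)" for t
      unfolding q_def p_def has_field_derivative_def
      by (auto intro!: derivative_eq_intros ext simp: inner_commute algebra_simps)
    have p: "(p has_real_derivative - 2 * (norm h)\<^sup>2) (at t)" for t
      unfolding p_def has_field_derivative_def
      by (auto intro!: derivative_eq_intros ext simp: power2_norm_eq_inner)
    define g' where "g' t = flat 2 (q t) * p t" for t
    define g'' where "g'' t = (flat 4 (q t) - 2 * flat 3 (q t)) * (p t)\<^sup>2 + flat 2 (q t) * (- 2 * (norm h)\<^sup>2)" for t
    have "((\<lambda>t. flat 0 (q t)) has_real_derivative g' t) (at t)" for t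
      using DERIV_chain2[OF flat_has_derivative[of 0 "q t"] q] by (simp add: g'_def numeral_2_eq_2)
    moreover have "(g' has_real_derivative g'' t) (at t)" for t
    proof -
      have "((\<lambda>t. flat 2 (q t)) has_real_derivative (flat 4 (q t) - 2 * flat 3 (q t)) * p t) (at t)"
        using DERIV_chain2[OF flat_has_derivative[of 2 "q t"] q] by simp
      from DERIV_mult[OF this p] show ?thesis
        unfolding g'_def g''_def by (simp add: power2_eq_square mult_ac add_ac)
    qed
    moreover have "\<bar>g'' t\<bar> \<le> N * (norm h)\<^sup>2" for t
    proof (cases "q t \<le> 0")
      case True
      then show ?thesis using N by (simp add: g''_def flat_def)
    next
      case False
      then have "(norm (x + t *\<^sub>R h))\<^sup>2 \<le> r\<^sup>2" by (simp add: q_def power2_norm_eq_inner)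
      then have "(2 * norm (x + t *\<^sub>R h) * norm h)\<^sup>2 \<le> 4 * r\<^sup>2 * (norm h)\<^sup>2"
        by (simp add: power_mult_distrib mult_right_mono)
      moreover have "\<bar>p t\<bar> \<le> 2 * norm (x + t *\<^sub>R h) * norm h"
        using Cauchy_Schwarz_ineq2[of "x + t *\<^sub>R h" h] by (simp add: p_def abs_mult)
      then have "\<bar>p t\<bar>\<^sup>2 \<le> (2 * norm (x + t *\<^sub>R h) * norm h)\<^sup>2"
        by (intro power_mono) auto
      ultimately have p2: "(p t)\<^sup>2 \<le> 4 * r\<^sup>2 * (norm h)\<^sup>2" by simp
      have "\<bar>flat 4 (q t) - 2 * flat 3 (q t)\<bar> \<le> C4 + 2 * C3"
        using C3(2)[of "q t"] C4(2)[of "q t"] flat_nonneg[of 3 "q t"] flat_nonneg[of 4 "q t"] by linarith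
      then have 1: "\<bar>flat 4 (q t) - 2 * flat 3 (q t)\<bar> * (p t)\<^sup>2 \<le> (C4 + 2 * C3) * (4 * r\<^sup>2 * (norm h)\<^sup>2)"
        using p2 C3 C4 by (intro mult_mono) auto
      have 2: "flat 2 (q t) * (2 * (norm h)\<^sup>2) \<le> C2 * (2 * (norm h)\<^sup>2)"
        using C2 by (intro mult_right_mono) auto
      have "\<bar>g'' t\<bar> \<le> \<bar>(flat 4 (q t) - 2 * flat 3 (q t)) * (p t)\<^sup>2\<bar> + \<bar>flat 2 (q t) * (- 2 * (norm h)\<^sup>2)\<bar>"
        unfolding g''_def by (rule abs_triangle_ineq)
      also have "\<dots> \<le> (C4 + 2 * C3) * (4 * r\<^sup>2 * (norm h)\<^sup>2) + C2 * (2 * (norm h)\<^sup>2)"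
        using 1 2 by (simp add: abs_mult)
      finally show ?thesis by (simp add: N_def algebra_simps)
    qed
    ultimately have "\<bar>flat 0 (q 1) + flat 0 (q (-1)) - 2 * flat 0 (q 0)\<bar> \<le> 2 * (N * (norm h)\<^sup>2)"
      by (rule second_difference_bound)
    then show ?thesis by (simp add: q_def bump_def power2_norm_eq_inner)
  qed
  have "\<bar>bump r (x + h) + bump r (x - h) - 2 * bump r x\<bar> \<le> (4 * C0 + 2 * N) * min 1 ((norm h)\<^sup>2)" for x h :: 'a
  proof (cases "(norm h)\<^sup>2 \<le> 1")
    case True
    have "2 * (N * (norm h)\<^sup>2) \<le> (4 * C0 + 2 * N) * (norm h)\<^sup>2"
      using C0(1) by (simp add: algebra_simps)
    with quad[of x h] True show ?thesis by (simp add: min_def)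
  next
    case False
    have "\<bar>bump r (x + h) + bump r (x - h) - 2 * bump r x\<bar> \<le> 4 * C0"
      using C0(2)[of x] C0(2)[of "x + h"] C0(2)[of "x - h"]
        bump_nonneg[of r x] bump_nonneg[of r "x + h"] bump_nonneg[of r "x - h"] C0(1) by linarith
    with False N show ?thesis by simp
  qed
  then show ?thesis by blast
qed

section \<open>The operator on test functions\<close>

text \<open>\<open>symmetric_op J\<close> is the symmetrized form of the operator with jump kernel \<open>J\<close>: averaging over \<open>h\<close> and
\<open>- h\<close> turns the principal value into an absolutely convergent integral.\<close>
definition second_difference :: "('a::real_normed_vector \<Rightarrow> real) \<Rightarrow> 'a \<Rightarrow> 'a \<Rightarrow> real" where
  "second_difference \<xi> y h = \<xi> (y + h) + \<xi> (y - h) - 2 * \<xi> y"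

definition symmetric_op :: "('a::euclidean_space \<Rightarrow> real) \<Rightarrow> ('a \<Rightarrow> real) \<Rightarrow> 'a \<Rightarrow> real" where
  "symmetric_op J \<xi> y = (\<integral>h. second_difference \<xi> y h * J h \<partial>lborel) / 2"

lemma lborel_distr_uminus_euclidean: "distr lborel borel uminus = (lborel :: 'a::euclidean_space measure)"
  by (subst lborel_affine[of "-1" 0])
     (auto simp: density_1 one_ennreal_def[symmetric])

lemma lborel_integral_uminus:
  fixes g :: "'a::euclidean_space \<Rightarrow> real"
  assumes [measurable]: "g \<in> borel_measurable borel"
  shows "(\<integral>h. g (- h) \<partial>lborel) = (\<integral>h. g h \<partial>lborel)"
  by (subst (2) lborel_distr_uminus_euclidean[symmetric]) (simp add: integral_distr)

lemma lborel_integrable_uminus: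
  fixes g :: "'a::euclidean_space \<Rightarrow> real"
  assumes "integrable lborel g"
  shows "integrable lborel (\<lambda>h. g (- h))"
  using assms by (subst (asm) lborel_distr_uminus_euclidean[symmetric]) (erule integrable_distr[rotated], simp)

lemma lborel_integral_translation:
  fixes g :: "'a::euclidean_space \<Rightarrow> real"
  assumes [measurable]: "g \<in> borel_measurable borel"
  shows "(\<integral>h. g (c + h) \<partial>lborel) = (\<integral>h. g h \<partial>lborel)"
  by (subst (2) lborel_distr_plus[of c, symmetric]) (simp add: integral_distr)

lemma lborel_nn_integral_translation:
  fixes g :: "'a::euclidean_space \<Rightarrow> ennreal"
  assumes [measurable]: "g \<in> borel_measurable borel"
  shows "(\<integral>\<^sup>+h. g (c + h) \<partial>lborel) = (\<integral>\<^sup>+h. g h \<partial>lborel)"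
  by (subst (2) lborel_distr_plus[of c, symmetric]) (simp add: nn_integral_distr)

lemma lborel_nn_integral_reflection:
  fixes g :: "'a::euclidean_space \<Rightarrow> ennreal"
  assumes [measurable]: "g \<in> borel_measurable borel"
  shows "(\<integral>\<^sup>+h. g (c - h) \<partial>lborel) = (\<integral>\<^sup>+h. g h \<partial>lborel)"
proof -
  have "(\<integral>\<^sup>+h. g (c - h) \<partial>lborel) = (\<integral>\<^sup>+h. g (c + h) \<partial>lborel)"
    by (subst (2) lborel_distr_uminus_euclidean[symmetric]) (simp add: nn_integral_distr)
  then show ?thesis by (simp add: lborel_nn_integral_translation)
qed

text \<open>The second factor of the product space is the completed measure, because super- and subsolutions
are only Lebesgue measurable.\<close>
lemma sigma_finite_lebesgue: "sigma_finite_measure (lebesgue :: 'a::euclidean_space measure)"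
proof
  obtain A :: "'a set set" where "countable A" "A \<subseteq> sets lborel" "\<Union>A = space lborel"
      "\<forall>a\<in>A. emeasure lborel a \<noteq> \<infinity>"
    using lborel.sigma_finite_countable by blast
  then show "\<exists>A::'a set set. countable A \<and> A \<subseteq> sets lebesgue \<and> \<Union>A = space lebesgue \<and>
      (\<forall>a\<in>A. emeasure lebesgue a \<noteq> \<infinity>)"
    by (intro exI[of _ A]) auto
qed

interpretation lborel_lebesgue: pair_sigma_finite
    "lborel :: 'a::euclidean_space measure" "lebesgue :: 'a measure"
  unfolding pair_sigma_finite_def using sigma_finite_lebesgue lborel.sigma_finite_measure_axioms by blast

text \<open>A radially decreasing Levy density, positive away from the origin. The last assumption says
that far out a unit increase of the radius costs at most a constant factor. The value at the
origin is only required to be non-negative, since it concerns a null set.\<close>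
locale levy_kernel =
  fixes J :: "'a::euclidean_space \<Rightarrow> real"
  assumes J_measurable [measurable]: "J \<in> borel_measurable borel"
    and J_nonneg: "0 \<le> J x"
    and J_pos: "x \<noteq> 0 \<Longrightarrow> 0 < J x"
    and J_antimono: "x \<noteq> 0 \<Longrightarrow> norm x \<le> norm y \<Longrightarrow> J y \<le> J x"
    and J_integrable: "integrable lborel (\<lambda>h. min 1 ((norm h)\<^sup>2) * J h)"
    and J_shift: "\<exists>C. \<forall>x y. 3 \<le> norm x \<longrightarrow> norm y = norm x + 1 \<longrightarrow> J x \<le> C * J y"
begin

lemma J_minus [simp]: "J (- h) = J h"
  using J_antimono[of h "- h"] J_antimono[of "- h" h] by (cases "h = 0") auto

lemma J_shift_nat:
  "\<exists>C\<ge>0. \<forall>x y. 3 \<le> norm x \<longrightarrow> y \<noteq> 0 \<longrightarrow> norm y \<le> norm x + real n \<longrightarrow> J x \<le> C * J y"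
proof (induction n)
  case 0
  show ?case by (intro exI[of _ 1]) (auto intro: J_antimono)
next
  case (Suc n)
  then obtain C where C: "0 \<le> C"
    "\<And>x y. 3 \<le> norm x \<Longrightarrow> y \<noteq> 0 \<Longrightarrow> norm y \<le> norm x + real n \<Longrightarrow> J x \<le> C * J y" by blast
  obtain D where D: "\<And>x y. 3 \<le> norm x \<Longrightarrow> norm y = norm x + 1 \<Longrightarrow> J x \<le> D * J y"
    using J_shift by blast
  have "J x \<le> \<bar>D\<bar> * C * J y" if "3 \<le> norm x" "y \<noteq> 0" "norm y \<le> norm x + real (Suc n)" for x y
  proof -
    define z where "z = ((norm x + 1) / norm x) *\<^sub>R x"
    have "x \<noteq> 0" using that by auto
    then have z: "norm z = norm x + 1" by (simp add: z_def)
    have "J x \<le> D * J z" using D that z by simp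
    also have "\<dots> \<le> \<bar>D\<bar> * J z" using J_nonneg by (intro mult_right_mono) auto
    also have "\<dots> \<le> \<bar>D\<bar> * (C * J y)" using that z by (intro mult_left_mono C) auto
    finally show ?thesis by (simp add: mult.assoc)
  qed
  with C(1) show ?case by (intro exI[of _ "\<bar>D\<bar> * C"]) auto
qed

lemma weight_lower_bound:
  "\<exists>m>0. \<forall>y. y \<noteq> 0 \<longrightarrow> norm y \<le> R \<longrightarrow> m \<le> min 1 (J y)"
proof -
  obtain e :: 'a where e: "norm e = max R 1" by (rule vector_choose_size[of "max R 1"]) auto
  then have "e \<noteq> 0" by auto
  have "min 1 (J e) \<le> min 1 (J y)" if "y \<noteq> 0" "norm y \<le> R" for y
    using that J_antimono[of y e] e by (intro min.mono) auto
  moreover have "0 < min 1 (J e)" using J_pos[OF \<open>e \<noteq> 0\<close>] by simp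
  ultimately show ?thesis by blast
qed

end

text \<open>A non-negative bounded test function supported in the ball of radius \<open>R\<close>, known only through the size
of its second differences.\<close>
locale levy_test = levy_kernel J for J :: "'a::euclidean_space \<Rightarrow> real" +
  fixes \<xi> :: "'a \<Rightarrow> real" and A M R :: real
  assumes xi_measurable [measurable]: "\<xi> \<in> borel_measurable borel"
    and xi_nonneg: "0 \<le> \<xi> x"
    and xi_le: "\<xi> x \<le> M"
    and xi_support: "R \<le> norm x \<Longrightarrow> \<xi> x = 0"
    and R_nonneg: "0 \<le> R"
    and xi_second_difference: "\<bar>second_difference \<xi> y h\<bar> \<le> A * min 1 ((norm h)\<^sup>2)"
begin

lemma M_nonneg: "0 \<le> M" using xi_nonneg[of 0] xi_le[of 0] by linarith

lemma second_difference_measurable [measurable]: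
  "(\<lambda>x. second_difference \<xi> (f x) (g x)) \<in> borel_measurable N"
  if [measurable]: "f \<in> borel_measurable N" "g \<in> borel_measurable N"
  unfolding second_difference_def by measurable

lemma second_difference_J_bound:
  "\<bar>second_difference \<xi> y h * J h\<bar> \<le> A * (min 1 ((norm h)\<^sup>2) * J h)"
  using mult_right_mono[OF xi_second_difference[of y h] J_nonneg[of h]] J_nonneg[of h]
  by (simp add: abs_mult mult.assoc)

lemma truncated_integral:
  assumes "0 < \<epsilon>"
  shows "(LINT z:{z. \<epsilon> < norm (z - y)}|lebesgue. (\<xi> z - \<xi> y) * J (z - y))
    = (\<integral>h. indicator {h. \<epsilon> < norm h} h * (second_difference \<xi> y h * J h) \<partial>lborel) / 2"
proof -
  define g where "g h = indicator {h. \<epsilon> < norm h} h * ((\<xi> (y + h) - \<xi> y) * J h)" for h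
  have [measurable]: "g \<in> borel_measurable borel" unfolding g_def by measurable
  have g: "integrable lborel g"
  proof (rule Bochner_Integration.integrable_bound)
    define m where "m = min 1 (\<epsilon>\<^sup>2)"
    have m: "0 < m" using assms by (simp add: m_def)
    show "integrable lborel (\<lambda>h. M / m * (min 1 ((norm h)\<^sup>2) * J h))"
      using J_integrable by simp
    have "norm (g h) \<le> norm (M / m * (min 1 ((norm h)\<^sup>2) * J h))" for h
    proof (cases "\<epsilon> < norm h")
      case True
      have "\<bar>\<xi> (y + h) - \<xi> y\<bar> \<le> M"
        using xi_nonneg[of y] xi_nonneg[of "y + h"] xi_le[of y] xi_le[of "y + h"] by linarith
      also have "M * 1 \<le> M * (min 1 ((norm h)\<^sup>2) / m)"
      proof -
        have "m \<le> min 1 ((norm h)\<^sup>2)"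
          unfolding m_def using True assms power_mono[of \<epsilon> "norm h" 2] by (intro min.mono) auto
        then show ?thesis using m M_nonneg by (intro mult_left_mono) auto
      qed
      finally have "\<bar>\<xi> (y + h) - \<xi> y\<bar> * J h \<le> M * (min 1 ((norm h)\<^sup>2) / m) * J h"
        using J_nonneg by (intro mult_right_mono) auto
      then show ?thesis
        using True J_nonneg[of h] M_nonneg m by (simp add: g_def abs_mult)
    qed (simp add: g_def)
    then show "AE h in lborel. norm (g h) \<le> norm (M / m * (min 1 ((norm h)\<^sup>2) * J h))" by simp
  qed measurable
  have "(LINT z:{z. \<epsilon> < norm (z - y)}|lebesgue. (\<xi> z - \<xi> y) * J (z - y)) = (\<integral>z. g (z - y) \<partial>lebesgue)"
    unfolding set_lebesgue_integral_def g_def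
    by (intro Bochner_Integration.integral_cong) (auto simp: indicator_def)
  also have "\<dots> = (\<integral>z. g (z - y) \<partial>lborel)"
    by (rule integral_completion) measurable
  also have "\<dots> = (\<integral>h. g h \<partial>lborel)"
    using lborel_integral_translation[of g "- y"] by simp
  also have "\<dots> = ((\<integral>h. g h \<partial>lborel) + (\<integral>h. g (- h) \<partial>lborel)) / 2"
    by (simp add: lborel_integral_uminus)
  also have "\<dots> = (\<integral>h. g h + g (- h) \<partial>lborel) / 2"
    using g lborel_integrable_uminus[OF g] by simp
  also have "(\<lambda>h. g h + g (- h)) = (\<lambda>h. indicator {h. \<epsilon> < norm h} h * (second_difference \<xi> y h * J h))"
    by (auto simp: g_def second_difference_def indicator_def algebra_simps)
  finally show ?thesis .
qed

lemma truncated_integral_tendsto: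
  "((\<lambda>\<epsilon>. LINT z:{z. \<epsilon> < norm (z - y)}|lebesgue. (\<xi> z - \<xi> y) * J (z - y)) \<longlongrightarrow> symmetric_op J \<xi> y)
    (at_right 0)"
  unfolding tendsto_at_iff_sequentially comp_def
proof (intro allI impI)
  fix X :: "nat \<Rightarrow> real"
  assume X: "\<forall>i. X i \<in> {0<..} - {0}" "X \<longlonglongrightarrow> 0"
  have "(\<lambda>i. (\<integral>h. indicator {h. X i < norm h} h * (second_difference \<xi> y h * J h) \<partial>lborel))
      \<longlonglongrightarrow> (\<integral>h. second_difference \<xi> y h * J h \<partial>lborel)"
  proof (rule integral_dominated_convergence)
    show "integrable lborel (\<lambda>h. A * (min 1 ((norm h)\<^sup>2) * J h))" using J_integrable by simp
    show "AE h in lborel. norm (indicator {h. X i < norm h} h * (second_difference \<xi> y h * J h))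
        \<le> A * (min 1 ((norm h)\<^sup>2) * J h)" for i
    proof (rule AE_I2)
      fix h
      have "norm (indicator {h. X i < norm h} h * (second_difference \<xi> y h * J h))
          \<le> \<bar>second_difference \<xi> y h * J h\<bar>" by (simp add: indicator_def)
      then show "norm (indicator {h. X i < norm h} h * (second_difference \<xi> y h * J h))
          \<le> A * (min 1 ((norm h)\<^sup>2) * J h)"
        using second_difference_J_bound[of y h] by linarith
    qed
    show "AE h in lborel. (\<lambda>i. indicator {h. X i < norm h} h * (second_difference \<xi> y h * J h))
        \<longlonglongrightarrow> second_difference \<xi> y h * J h"
      using AE_lborel_singleton[of 0]
    proof eventually_elim
      case (elim h)
      then have "eventually (\<lambda>i. X i < norm h) sequentially"
        using X(2) by (intro order_tendstoD(2)) auto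
      then have "eventually (\<lambda>i. indicator {h. X i < norm h} h * (second_difference \<xi> y h * J h)
          = second_difference \<xi> y h * J h) sequentially"
        by eventually_elim simp
      then show ?case by (rule tendsto_eventually)
    qed
  qed measurable
  then have "(\<lambda>i. (\<integral>h. indicator {h. X i < norm h} h * (second_difference \<xi> y h * J h) \<partial>lborel) / 2)
      \<longlonglongrightarrow> symmetric_op J \<xi> y"
    unfolding symmetric_op_def by (intro tendsto_intros) auto
  moreover have "0 < X i" for i using X(1) by auto
  ultimately show "(\<lambda>i. LINT z:{z. X i < norm (z - y)}|lebesgue. (\<xi> z - \<xi> y) * J (z - y))
      \<longlonglongrightarrow> symmetric_op J \<xi> y"
    by (simp only: truncated_integral)
qed

lemma symmetric_op_measurable [measurable]: "symmetric_op J \<xi> \<in> borel_measurable borel"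
  unfolding symmetric_op_def by measurable

text \<open>The decisive estimate: \<open>L \<xi>\<close>, even with absolute values inside the integral, is bounded by a
multiple of the weight \<open>min 1 (J y)\<close>. Close to the support this is the integrability of \<open>J\<close> against
\<open>min 1 \<bar>h\<bar>\<^sup>2\<close>. Far away only jumps into the support matter; they have length at least
\<open>\<bar>y\<bar> - R\<close>, and \<open>J_shift_nat\<close> compares their density with \<open>J y\<close>.\<close>
lemma second_difference_decay:
  "\<exists>K\<ge>0. \<forall>y. y \<noteq> 0 \<longrightarrow>
    (\<integral>\<^sup>+h. ennreal \<bar>second_difference \<xi> y h * J h\<bar> \<partial>lborel) \<le> ennreal (K * min 1 (J y))"
proof -
  define I where "I = (\<integral>h. A * (min 1 ((norm h)\<^sup>2) * J h) \<partial>lborel)"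
  have I: "(\<integral>\<^sup>+h. ennreal \<bar>second_difference \<xi> y h * J h\<bar> \<partial>lborel) \<le> ennreal I" for y
  proof -
    have "(\<integral>\<^sup>+h. ennreal \<bar>second_difference \<xi> y h * J h\<bar> \<partial>lborel)
        \<le> (\<integral>\<^sup>+h. ennreal (A * (min 1 ((norm h)\<^sup>2) * J h)) \<partial>lborel)"
      using second_difference_J_bound by (intro nn_integral_mono ennreal_leI)
    also have "\<dots> = ennreal I" unfolding I_def
    proof (rule nn_integral_eq_integral)
      show "AE h in lborel. 0 \<le> A * (min 1 ((norm h)\<^sup>2) * J h)"
        using second_difference_J_bound abs_ge_zero order_trans by (intro AE_I2) blast
    qed (use J_integrable in simp)
    finally show ?thesis .
  qed
  define S where "S = M * measure lborel (cball (0::'a) R)"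
  have S: "0 \<le> S" using M_nonneg by (simp add: S_def)
  have xi_int: "(\<integral>\<^sup>+z. ennreal (\<xi> z) \<partial>lborel) \<le> ennreal S"
  proof -
    have "(\<integral>\<^sup>+z. ennreal (\<xi> z) \<partial>lborel) \<le> (\<integral>\<^sup>+(z::'a). ennreal M * indicator (cball 0 R) z \<partial>lborel)"
    proof (rule nn_integral_mono)
      fix z :: 'a
      show "ennreal (\<xi> z) \<le> ennreal M * indicator (cball 0 R) z"
        using xi_le[of z] xi_support[of z] by (auto simp: indicator_def intro!: ennreal_leI)
    qed
    also have "\<dots> = ennreal M * emeasure lborel (cball (0::'a) R)"
      by (rule nn_integral_cmult_indicator) simp
    also have "\<dots> = ennreal S"
      using M_nonneg emeasure_lborel_cball_finite[of "0::'a" R]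
      by (simp add: S_def emeasure_eq_ennreal_measure ennreal_mult)
    finally show ?thesis .
  qed
  obtain m where m: "0 < m" "\<And>y. y \<noteq> 0 \<Longrightarrow> norm y \<le> R + 3 \<Longrightarrow> m \<le> min 1 (J y)"
    using weight_lower_bound[of "R + 3"] by blast
  obtain C where C: "0 \<le> C"
    "\<And>x y. 3 \<le> norm x \<Longrightarrow> y \<noteq> 0 \<Longrightarrow> norm y \<le> norm x + real (nat \<lceil>R\<rceil>) \<Longrightarrow> J x \<le> C * J y"
    using J_shift_nat by blast
  obtain e :: 'a where e: "norm e = 3" by (rule vector_choose_size[of 3]) auto
  define K where "K = \<bar>I\<bar> / m + 2 * S * max C (J e)"
  have Kpos: "0 \<le> \<bar>I\<bar> / m" "0 \<le> 2 * S * max C (J e)" using m S C by simp_all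
  have "(\<integral>\<^sup>+h. ennreal \<bar>second_difference \<xi> y h * J h\<bar> \<partial>lborel) \<le> ennreal (K * min 1 (J y))"
    if y: "y \<noteq> 0" for y
  proof (cases "norm y \<le> R + 3")
    case True
    have "I \<le> \<bar>I\<bar> / m * m" using m by simp
    also have "\<dots> \<le> K * min 1 (J y)"
      using m True y Kpos J_nonneg unfolding K_def by (intro mult_mono) auto
    finally show ?thesis using I[of y] ennreal_leI order_trans by blast
  next
    case False
    define x where "x = ((norm y - R) / norm y) *\<^sub>R y"
    have x: "norm x = norm y - R" using False y R_nonneg by (simp add: x_def)
    have pt: "\<bar>second_difference \<xi> y h * J h\<bar> \<le> J x * (\<xi> (y + h) + \<xi> (y - h))" for h
    proof (cases "\<xi> (y + h) + \<xi> (y - h) = 0")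
      case True
      then show ?thesis using xi_support[of y] False by (simp add: second_difference_def)
    next
      case nz: False
      then have "norm (y + h) < R \<or> norm (y - h) < R" using xi_support
        by (metis add_0 linorder_not_less)
      then have "norm x \<le> norm h"
        using norm_triangle_ineq2[of y "- h"] norm_triangle_ineq2[of y h] x by auto
      moreover have "x \<noteq> 0" using x False by auto
      ultimately have "J h \<le> J x" by (intro J_antimono)
      moreover have "second_difference \<xi> y h = \<xi> (y + h) + \<xi> (y - h)"
        using xi_support[of y] False by (simp add: second_difference_def)
      ultimately show ?thesis
        using J_nonneg[of h] xi_nonneg[of "y + h"] xi_nonneg[of "y - h"]
        by (simp add: abs_mult mult.commute mult_right_mono)
    qed
    have "(\<integral>\<^sup>+h. ennreal \<bar>second_difference \<xi> y h * J h\<bar> \<partial>lborel)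
        \<le> (\<integral>\<^sup>+h. ennreal (J x) * (ennreal (\<xi> (y + h)) + ennreal (\<xi> (y - h))) \<partial>lborel)"
      using pt J_nonneg xi_nonneg
      by (intro nn_integral_mono) (auto simp: ennreal_mult'[symmetric] ennreal_plus[symmetric] simp del: ennreal_plus intro!: ennreal_leI)
    also have "\<dots> = ennreal (J x) * ((\<integral>\<^sup>+h. ennreal (\<xi> (y + h)) \<partial>lborel) + (\<integral>\<^sup>+h. ennreal (\<xi> (y - h)) \<partial>lborel))"
      by (simp add: nn_integral_cmult nn_integral_add)
    also have "\<dots> = ennreal (J x) * ((\<integral>\<^sup>+z. ennreal (\<xi> z) \<partial>lborel) + (\<integral>\<^sup>+z. ennreal (\<xi> z) \<partial>lborel))"
      using lborel_nn_integral_translation[of "\<lambda>z. ennreal (\<xi> z)" y]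
        lborel_nn_integral_reflection[of "\<lambda>z. ennreal (\<xi> z)" y] by simp
    also have "\<dots> \<le> ennreal (J x) * (ennreal S + ennreal S)"
      using xi_int by (intro mult_left_mono add_mono) auto
    also have "\<dots> = ennreal (2 * S * J x)"
      using S J_nonneg[of x] by (simp add: ennreal_mult'[symmetric] ennreal_plus[symmetric] mult_ac del: ennreal_plus)
    also have "\<dots> \<le> ennreal (K * min 1 (J y))"
    proof (rule ennreal_leI)
      have "J x \<le> C * J y" using x False y real_nat_ceiling_ge[of R] by (intro C) linarith+
      also have "\<dots> \<le> max C (J e) * J y" using J_nonneg by (intro mult_right_mono) auto
      finally have "J x \<le> max C (J e) * J y" .
      moreover have "e \<noteq> 0" using e by auto
      then have "J x \<le> J e" using e x False by (intro J_antimono) auto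
      then have "J x \<le> max C (J e) * 1" by simp
      ultimately have "J x \<le> max C (J e) * min 1 (J y)" by (simp add: min_def)
      then have "2 * S * J x \<le> 2 * S * (max C (J e) * min 1 (J y))" using S by (intro mult_left_mono) auto
      also have "\<dots> \<le> K * min 1 (J y)"
      proof -
        have "0 \<le> \<bar>I\<bar> / m * min 1 (J y)" using Kpos J_nonneg by (intro mult_nonneg_nonneg) auto
        then show ?thesis unfolding K_def distrib_right mult.assoc by linarith
      qed
      finally show "2 * S * J x \<le> K * min 1 (J y)" .
    qed
    finally show ?thesis .
  qed
  moreover have "0 \<le> K" using Kpos by (simp add: K_def)
  ultimately show ?thesis by blast
qed

end

section \<open>Moving the operator from the test function to the averages\<close>

lemma measurable_snd_borel [measurable]:
  "snd \<in> borel_measurable (N \<Otimes>\<^sub>M (lebesgue :: 'a::euclidean_space measure))"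
  using measurable_compose[OF measurable_snd, of "\<lambda>x::'a. x" lebesgue borel N]
  by (simp add: measurable_completion)

context levy_kernel
begin

lemma locally_integrable:
  assumes [measurable]: "w \<in> borel_measurable lebesgue"
    and "integrable lebesgue (\<lambda>y. min 1 (J y) * w y)"
  shows "integrable lebesgue (\<lambda>y. indicator (cball 0 \<rho>) y * w y)"
proof -
  obtain m where m: "0 < m" "\<And>y. y \<noteq> 0 \<Longrightarrow> norm y \<le> \<rho> \<Longrightarrow> m \<le> min 1 (J y)"
    using weight_lower_bound[of \<rho>] by blast
  have int: "integrable lebesgue (\<lambda>y. inverse m * (min 1 (J y) * w y))" using assms by simp
  have "AE y::'a in lebesgue. y \<noteq> 0" using AE_lborel_singleton[of 0] by (rule AE_completion)
  then have "AE y in lebesgue. norm (indicator (cball 0 \<rho>) y * w y) \<le> norm (inverse m * (min 1 (J y) * w y))"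
  proof eventually_elim
    case (elim y)
    show ?case
    proof (cases "norm y \<le> \<rho>")
      case True
      have "1 * \<bar>w y\<bar> \<le> (inverse m * min 1 (J y)) * \<bar>w y\<bar>"
        using m(2)[OF elim True] m(1) by (intro mult_right_mono) (auto simp: field_simps)
      then show ?thesis using m(1) J_nonneg[of y] True by (simp add: abs_mult)
    qed simp
  qed
  then show ?thesis
    by (rule Bochner_Integration.integrable_bound[OF int, rotated])
       (intro borel_measurable_times borel_measurable_indicator, auto)
qed

end

context levy_test
begin

text \<open>The decay of \<open>L \<xi>\<close> gives absolute integrability on the product space for every \<open>w\<close> integrable against
the weight, so that Fubini's theorem moves the operator from \<open>\<xi>\<close> to the averages of \<open>w\<close>.\<close>
context
  fixes w :: "'a \<Rightarrow> real"
  assumes w_measurable [measurable]: "w \<in> borel_measurable lebesgue"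
    and w_integrable: "integrable lebesgue (\<lambda>y. min 1 (J y) * w y)"
begin

lemma product_integrable:
  "integrable (lborel \<Otimes>\<^sub>M lebesgue) (\<lambda>(h, y). w y * (second_difference \<xi> y h * J h))"
proof (rule integrableI_bounded)
  show meas: "(\<lambda>(h, y). w y * (second_difference \<xi> y h * J h)) \<in> borel_measurable (lborel \<Otimes>\<^sub>M lebesgue)"
    by measurable
  obtain K where K: "0 \<le> K" "\<And>y. y \<noteq> 0 \<Longrightarrow>
      (\<integral>\<^sup>+h. ennreal \<bar>second_difference \<xi> y h * J h\<bar> \<partial>lborel) \<le> ennreal (K * min 1 (J y))"
    using second_difference_decay by blast
  have "(\<integral>\<^sup>+p. ennreal (norm (case p of (h, y) \<Rightarrow> w y * (second_difference \<xi> y h * J h))) \<partial>(lborel \<Otimes>\<^sub>M lebesgue))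
      = (\<integral>\<^sup>+y. \<integral>\<^sup>+h. ennreal \<bar>w y\<bar> * ennreal \<bar>second_difference \<xi> y h * J h\<bar> \<partial>lborel \<partial>lebesgue)"
    by (subst lborel_lebesgue.nn_integral_snd[symmetric]) (simp_all add: abs_mult ennreal_mult)
  also have "\<dots> = (\<integral>\<^sup>+y. ennreal \<bar>w y\<bar> * (\<integral>\<^sup>+h. ennreal \<bar>second_difference \<xi> y h * J h\<bar> \<partial>lborel) \<partial>lebesgue)"
    by (intro nn_integral_cong nn_integral_cmult) measurable
  also have "\<dots> \<le> (\<integral>\<^sup>+y. ennreal (norm (K * (min 1 (J y) * w y))) \<partial>lebesgue)"
  proof (rule nn_integral_mono_AE)
    have "AE y::'a in lebesgue. y \<noteq> 0" using AE_lborel_singleton[of 0] by (rule AE_completion)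
    then show "AE y in lebesgue. ennreal \<bar>w y\<bar> * (\<integral>\<^sup>+h. ennreal \<bar>second_difference \<xi> y h * J h\<bar> \<partial>lborel)
        \<le> ennreal (norm (K * (min 1 (J y) * w y)))"
    proof eventually_elim
      case (elim y)
      have "ennreal \<bar>w y\<bar> * (\<integral>\<^sup>+h. ennreal \<bar>second_difference \<xi> y h * J h\<bar> \<partial>lborel)
          \<le> ennreal \<bar>w y\<bar> * ennreal (K * min 1 (J y))"
        using K(2)[OF elim] by (intro mult_left_mono) auto
      also have "\<dots> = ennreal (norm (K * (min 1 (J y) * w y)))"
        using K(1) J_nonneg[of y] by (simp add: ennreal_mult[symmetric] abs_mult mult_ac)
      finally show ?case .
    qed
  qed
  also have "\<dots> < \<infinity>"
    using integrable_mult_right[OF w_integrable, of K] unfolding integrable_iff_bounded by simp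
  finally show "(\<integral>\<^sup>+p. ennreal (norm (case p of (h, y) \<Rightarrow> w y * (second_difference \<xi> y h * J h))) \<partial>(lborel \<Otimes>\<^sub>M lebesgue)) < \<infinity>" .
qed

lemma symmetric_op_integrable: "integrable lebesgue (\<lambda>y. w y * symmetric_op J \<xi> y)"
proof -
  have "integrable lebesgue (\<lambda>y. (\<integral>h. w y * (second_difference \<xi> y h * J h) \<partial>lborel) / 2)"
    using lborel_lebesgue.integrable_snd[OF product_integrable] by (intro integrable_divide) auto
  then show ?thesis by (simp add: symmetric_op_def)
qed

lemma inner_integral_integrable:
  "integrable lborel (\<lambda>h. J h * (\<integral>y. w y * second_difference \<xi> y h \<partial>lebesgue))"
proof -
  have "integrable lborel (\<lambda>h. \<integral>y. w y * (second_difference \<xi> y h * J h) \<partial>lebesgue)"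
    by (rule lborel_lebesgue.integrable_fst[OF product_integrable])
  then show ?thesis
    by (simp only: mult.assoc[symmetric] integral_mult_left_zero mult.commute[of "J _"])
qed

lemma symmetric_op_duality:
  "(\<integral>y. w y * symmetric_op J \<xi> y \<partial>lebesgue)
    = (\<integral>h. J h * (\<integral>y. w y * second_difference \<xi> y h \<partial>lebesgue) \<partial>lborel) / 2"
proof -
  have "(\<integral>y. (\<integral>h. w y * (second_difference \<xi> y h * J h) \<partial>lborel) \<partial>lebesgue)
      = (\<integral>h. (\<integral>y. w y * (second_difference \<xi> y h * J h) \<partial>lebesgue) \<partial>lborel)"
    by (rule lborel_lebesgue.Fubini_integral[OF product_integrable])
  also have "\<dots> = (\<integral>h. J h * (\<integral>y. w y * second_difference \<xi> y h \<partial>lebesgue) \<partial>lborel)"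
    by (simp only: mult.assoc[symmetric] integral_mult_left_zero mult.commute[of "J _"])
  finally show ?thesis by (simp add: symmetric_op_def)
qed

end

end

section \<open>Mollification and the maximum principle\<close>

lemma bump_integrable: 
  assumes "0 \<le> r" shows "integrable lborel (bump r :: 'a::euclidean_space \<Rightarrow> real)"
proof -
  have "integrable lborel (\<lambda>x::'a. indicator (cball 0 r) x *\<^sub>R bump r x)"
    by (rule borel_integrable_compact) (auto intro: continuous_on_subset[OF bump_continuous])
  also have "(\<lambda>x::'a. indicator (cball 0 r) x *\<^sub>R bump r x) = bump r"
  proof
    fix x :: 'a
    show "indicator (cball 0 r) x *\<^sub>R bump r x = bump r x"
      using bump_eq_0[OF assms, of x] by (cases "norm x \<le> r") auto
  qed
  finally show ?thesis .
qed

lemma integral_bump_pos: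
  assumes "0 < r" shows "0 < (\<integral>x. bump r x \<partial>(lborel :: 'a::euclidean_space measure))"
proof (rule ccontr)
  assume "\<not> 0 < (\<integral>x. bump r x \<partial>(lborel :: 'a measure))"
  moreover have "0 \<le> (\<integral>x. bump r x \<partial>(lborel :: 'a measure))" by (rule integral_nonneg_AE) simp
  ultimately have "(\<integral>x. bump r x \<partial>(lborel :: 'a measure)) = 0" by linarith
  then have "AE x::'a in lborel. bump r x = 0"
    using integral_nonneg_eq_0_iff_AE[OF bump_integrable[of r]] assms by auto
  then have "AE x\<in>ball (0::'a) r in lebesgue. x \<in> {}"
    by (intro AE_completion) (auto simp: bump_pos elim!: eventually_mono dest: bump_pos[of _ r])
  from mem_closed_if_AE_lebesgue_open[OF _ _ this, of 0] show False using assms by simp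
qed

lemma integral_bump_shift:
  "integrable lebesgue (\<lambda>y::'a::euclidean_space. bump r (y - x))"
  "(\<integral>y. bump r (y - x) \<partial>lebesgue) = (\<integral>y. bump r y \<partial>(lborel :: 'a measure))" if "0 \<le> r"
proof -
  have [measurable]: "bump r \<in> borel_measurable (borel :: 'a measure)" by measurable
  have "integrable (distr lborel borel ((+) (- x))) (bump r :: 'a \<Rightarrow> real)"
    unfolding lborel_distr_plus by (rule bump_integrable[OF that])
  then have "integrable lborel (\<lambda>y::'a. bump r (- x + y))"
    by (rule integrable_distr[rotated]) simp
  then show "integrable lebesgue (\<lambda>y::'a. bump r (y - x))"
    by (subst integrable_completion) simp_all
  have "(\<integral>y. bump r (y - x) \<partial>lebesgue) = (\<integral>y. bump r (y - x) \<partial>lborel)"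
    by (rule integral_completion) measurable
  then show "(\<integral>y. bump r (y - x) \<partial>lebesgue) = (\<integral>y. bump r y \<partial>(lborel :: 'a measure))"
    using lborel_integral_translation[of "bump r" "- x"] by simp
qed

context levy_kernel
begin

lemma bump_levy_test:
  assumes "0 < r"
  shows "\<exists>A M R. levy_test J (\<lambda>x. bump r (x - c)) A M R"
proof -
  obtain A where A: "\<And>x h::'a. \<bar>bump r (x + h) + bump r (x - h) - 2 * bump r x\<bar> \<le> A * min 1 ((norm h)\<^sup>2)"
    using bump_second_difference[of r] assms by auto
  obtain M where M: "\<And>x::'a. bump r x \<le> M" using bump_bounded by blast
  have "levy_test J (\<lambda>x. bump r (x - c)) A M (norm c + r)"
  proof
    show "(\<lambda>x. bump r (x - c)) \<in> borel_measurable borel" by measurable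
    show "bump r (x - c) = 0" if "norm c + r \<le> norm x" for x
      using that norm_triangle_ineq2[of x c] assms by (intro bump_eq_0) auto
    show "\<bar>second_difference (\<lambda>x. bump r (x - c)) y h\<bar> \<le> A * min 1 ((norm h)\<^sup>2)" for y h
      using A[of "y - c" h] by (simp add: second_difference_def algebra_simps)
  qed (use assms M in auto)
  then show ?thesis by blast
qed

context
  fixes w :: "'a \<Rightarrow> real" and r :: real
  assumes w [measurable]: "w \<in> borel_measurable lebesgue"
    and w_int: "integrable lebesgue (\<lambda>y. min 1 (J y) * w y)"
    and r: "0 < r"
begin

text \<open>Below, \<open>\<lambda>x. \<integral>y. w y * bump r (y - x) \<partial>lebesgue\<close> is the (unnormalized) mollification of \<open>w\<close>.\<close>
lemma bump_average_dominated:
  "\<exists>M\<ge>0. \<forall>x y. norm x \<le> \<rho> \<longrightarrow> norm (w y * bump r (y - x)) \<le> M * \<bar>indicator (cball 0 (\<rho> + r)) y * w y\<bar>"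
proof -
  obtain M where M: "0 < M" "\<And>x::'a. bump r x \<le> M" using bump_bounded by blast
  have "norm (w y * bump r (y - x)) \<le> M * \<bar>indicator (cball 0 (\<rho> + r)) y * w y\<bar>" if "norm x \<le> \<rho>" for x y
  proof (cases "r \<le> norm (y - x)")
    case True
    then show ?thesis using bump_eq_0[of r "y - x"] r M(1) by simp
  next
    case False
    then have "norm y \<le> \<rho> + r" using norm_triangle_ineq2[of y x] that by linarith
    moreover have "\<bar>w y\<bar> * bump r (y - x) \<le> \<bar>w y\<bar> * M" by (intro mult_left_mono M(2)) simp
    ultimately show ?thesis by (simp add: abs_mult mult.commute)
  qed
  with M(1) show ?thesis by (intro exI[of _ M]) auto
qed

lemma bump_average_measurable: "(\<lambda>y. w y * bump r (y - x)) \<in> borel_measurable lebesgue"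
proof -
  have "(\<lambda>y. bump r (y - x)) \<in> borel_measurable lebesgue"
    by (rule measurable_completion) measurable
  then show ?thesis by (intro borel_measurable_times w)
qed

lemma bump_average_integrable: "integrable lebesgue (\<lambda>y. w y * bump r (y - x))"
proof -
  obtain M where M: "0 \<le> M" "\<And>x' y. norm x' \<le> norm x \<Longrightarrow>
      norm (w y * bump r (y - x')) \<le> M * \<bar>indicator (cball 0 (norm x + r)) y * w y\<bar>"
    using bump_average_dominated by blast
  have "integrable lebesgue (\<lambda>y. M * \<bar>indicator (cball 0 (norm x + r)) y * w y\<bar>)"
    by (intro integrable_mult_right integrable_abs locally_integrable w w_int)
  then show ?thesis
    by (rule Bochner_Integration.integrable_bound)
       (use M bump_average_measurable in \<open>auto intro!: AE_I2 order_trans[OF M(2)]\<close>)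
qed

lemma bump_average_continuous: "continuous_on UNIV (\<lambda>x. \<integral>y. w y * bump r (y - x) \<partial>lebesgue)"
  unfolding continuous_on_sequentially comp_def
proof (intro ballI allI impI, elim conjE)
  fix x and X :: "nat \<Rightarrow> 'a" assume lim: "X \<longlonglongrightarrow> x"
  from convergent_imp_bounded[OF lim] obtain \<rho> where \<rho>: "\<And>n. norm (X n) \<le> \<rho>"
    by (auto simp: bounded_iff)
  obtain M where M: "\<And>x' y. norm x' \<le> \<rho> \<Longrightarrow>
      norm (w y * bump r (y - x')) \<le> M * \<bar>indicator (cball 0 (\<rho> + r)) y * w y\<bar>"
    using bump_average_dominated by blast
  show "(\<lambda>n. \<integral>y. w y * bump r (y - X n) \<partial>lebesgue) \<longlonglongrightarrow> (\<integral>y. w y * bump r (y - x) \<partial>lebesgue)"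
  proof (rule integral_dominated_convergence)
    show "integrable lebesgue (\<lambda>y. M * \<bar>indicator (cball 0 (\<rho> + r)) y * w y\<bar>)"
      by (intro integrable_mult_right integrable_abs locally_integrable w w_int)
    show "AE y in lebesgue. norm (w y * bump r (y - X n)) \<le> M * \<bar>indicator (cball 0 (\<rho> + r)) y * w y\<bar>" for n
      using M[OF \<rho>] by blast
    show "AE y in lebesgue. (\<lambda>n. w y * bump r (y - X n)) \<longlonglongrightarrow> w y * bump r (y - x)"
    proof (rule AE_I2)
      fix y
      have "continuous_on UNIV (bump r :: 'a \<Rightarrow> real)" by (rule bump_continuous)
      then have "isCont (bump r) (y - x)" by (simp add: continuous_on_eq_continuous_at)
      then have "(\<lambda>n. bump r (y - X n)) \<longlonglongrightarrow> bump r (y - x)"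
        by (rule isCont_tendsto_compose) (intro tendsto_intros lim)
      then show "(\<lambda>n. w y * bump r (y - X n)) \<longlonglongrightarrow> w y * bump r (y - x)"
        by (intro tendsto_intros)
    qed
  qed (rule bump_average_measurable)+
qed

lemma second_difference_bump_average:
  "(\<integral>y. w y * second_difference (\<lambda>x. bump r (x - c)) y h \<partial>lebesgue)
    = (\<integral>y. w y * bump r (y - (c - h)) \<partial>lebesgue) + (\<integral>y. w y * bump r (y - (c + h)) \<partial>lebesgue)
      - 2 * (\<integral>y. w y * bump r (y - c) \<partial>lebesgue)"
proof -
  have "(\<integral>y. w y * second_difference (\<lambda>x. bump r (x - c)) y h \<partial>lebesgue)
      = (\<integral>y. w y * bump r (y - (c - h)) + w y * bump r (y - (c + h)) - 2 * (w y * bump r (y - c)) \<partial>lebesgue)"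
    by (intro Bochner_Integration.integral_cong) (auto simp: second_difference_def algebra_simps)
  then show ?thesis using bump_average_integrable by simp
qed

text \<open>At a global minimum \<open>c\<close> of the mollification of \<open>w\<close>, all its second differences are non-negative, and
those with long steps are positive; hence the operator applied to it is positive at \<open>c\<close>. By duality this
is the integral of \<open>w\<close> against the operator applied to the bump.\<close>
lemma bump_average_minimum:
  assumes min: "\<And>x. (\<integral>y. w y * bump r (y - c) \<partial>lebesgue) \<le> (\<integral>y. w y * bump r (y - x) \<partial>lebesgue)"
    and strict: "\<And>x. \<rho> < norm x \<Longrightarrow>
      (\<integral>y. w y * bump r (y - c) \<partial>lebesgue) < (\<integral>y. w y * bump r (y - x) \<partial>lebesgue)"
  shows "0 < (\<integral>y. w y * symmetric_op J (\<lambda>x. bump r (x - c)) y \<partial>lebesgue)"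
proof (rule ccontr)
  assume *: "\<not> ?thesis"
  obtain A M R where "levy_test J (\<lambda>x. bump r (x - c)) A M R" using bump_levy_test[OF r] by blast
  then interpret levy_test J "\<lambda>x. bump r (x - c)" A M R .
  define D where "D h = (\<integral>y. w y * second_difference (\<lambda>x. bump r (x - c)) y h \<partial>lebesgue)" for h
  have D: "0 \<le> D h" for h
    using min[of "c - h"] min[of "c + h"] unfolding D_def second_difference_bump_average by linarith
  have D_pos: "0 < D h" if "norm c + \<rho> < norm h" for h
    using min[of "c - h"] strict[of "c + h"] norm_triangle_ineq2[of h "- c"] that
    unfolding D_def second_difference_bump_average by (simp add: add.commute)
  have int: "integrable lborel (\<lambda>h. J h * D h)"
    unfolding D_def by (rule inner_integral_integrable[OF w w_int])
  have JD: "0 \<le> J h * D h" for h using J_nonneg D by simp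
  have "(\<integral>h. J h * D h \<partial>lborel) \<le> 0"
    using * unfolding symmetric_op_duality[OF w w_int] D_def by simp
  moreover have "0 \<le> (\<integral>h. J h * D h \<partial>lborel)" using JD by (intro integral_nonneg_AE) auto
  ultimately have "(\<integral>h. J h * D h \<partial>lborel) = 0" by simp
  then have "AE h in lborel. J h * D h = 0"
    using integral_nonneg_eq_0_iff_AE[OF int] JD by auto
  then have "AE h in lborel. h \<in> cball (0::'a) \<bar>norm c + \<rho>\<bar>"
  proof eventually_elim
    case (elim h)
    show ?case
    proof (rule ccontr)
      assume "h \<notin> cball 0 \<bar>norm c + \<rho>\<bar>"
      then have "norm c + \<rho> < norm h" "h \<noteq> 0" by auto
      with elim D_pos[of h] J_pos[of h] show False by simp
    qed
  qed
  then have "AE h\<in>UNIV in lebesgue. h \<in> cball (0::'a) \<bar>norm c + \<rho>\<bar>"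
    by (intro AE_completion) simp
  from mem_closed_if_AE_lebesgue_open[OF _ _ this] have "norm h \<le> \<bar>norm c + \<rho>\<bar>" for h :: 'a
    by auto
  moreover obtain h :: 'a where "norm h = \<bar>norm c + \<rho>\<bar> + 1"
    by (rule vector_choose_size[of "\<bar>norm c + \<rho>\<bar> + 1"]) auto
  ultimately show False by (metis add_le_same_cancel1 not_one_le_zero)
qed

end

text \<open>If \<open>w\<close> were negative somewhere in \<open>\<Omega>\<close>, its negative part \<open>v\<close> would be continuous with compact support
and have a minimum \<open>- m < 0\<close>. Mollify \<open>w\<close> at a scale at which \<open>v\<close> oscillates by less than \<open>m / 8\<close>.
Then the mollification attains its global minimum at a point whose whole mollification ball lies
in \<open>{x \<in> \<Omega>. w x < 0}\<close>, where \<open>w\<close> is a supersolution, and this contradicts the positivity of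
the operator at a minimum.\<close>
lemma maximum_principle:
  fixes w :: "'a \<Rightarrow> real"
  assumes w: "w \<in> borel_measurable lebesgue"
    and w_int: "integrable lebesgue (\<lambda>y. min 1 (J y) * w y)"
    and "open \<Omega>" "compact K" "K \<subseteq> \<Omega>" "continuous_on \<Omega> w"
    and outside: "AE x in lebesgue. x \<notin> K \<longrightarrow> 0 \<le> w x"
    and super: "\<And>c r. 0 < r \<Longrightarrow> cball c r \<subseteq> {x \<in> \<Omega>. w x < 0} \<Longrightarrow>
      (\<integral>y. w y * symmetric_op J (\<lambda>x. bump r (x - c)) y \<partial>lebesgue) \<le> 0"
  shows "\<forall>x\<in>\<Omega>. 0 \<le> w x"
proof (rule ccontr)
  assume "\<not> ?thesis"
  then obtain x1 where x1: "x1 \<in> \<Omega>" "w x1 < 0" by auto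
  have off_K: "0 \<le> w x" if "x \<in> \<Omega> - K" for x
  proof (rule ccontr)
    assume "\<not> 0 \<le> w x"
    \<comment> \<open>An open set that is null is empty.\<close>
    define S where "S = (\<Omega> - K) \<inter> w -` {..<0}"
    have "open S" unfolding S_def
      using assms by (intro continuous_open_preimage) (auto intro: continuous_on_subset compact_imp_closed open_Diff)
    moreover have "AE y\<in>S in lebesgue. y \<in> {}"
      using outside by eventually_elim (auto simp: S_def)
    ultimately show False
      using mem_closed_if_AE_lebesgue_open[of S "{}" x] that \<open>\<not> 0 \<le> w x\<close> by (auto simp: S_def)
  qed
  define v where "v x = (if x \<in> \<Omega> then min (w x) 0 else 0)" for x
  have v_off_K: "v x = 0" if "x \<notin> K" for x using off_K[of x] that by (auto simp: v_def)
  have v_cont: "continuous_on UNIV v"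
  proof -
    have "continuous_on \<Omega> (\<lambda>x. min (w x) 0)" using assms by (intro continuous_intros)
    then have "continuous_on \<Omega> v" by (rule continuous_on_eq) (simp add: v_def)
    moreover have "continuous_on (- K) v"
      using continuous_on_const[of _ 0] by (rule continuous_on_eq) (simp add: v_off_K)
    ultimately have "continuous_on (\<Omega> \<union> - K) v"
      using assms by (intro continuous_on_open_Un) (auto intro: compact_imp_closed open_Compl)
    moreover have "\<Omega> \<union> - K = UNIV" using assms by auto
    ultimately show ?thesis by simp
  qed
  have "x1 \<in> K" using off_K x1 by (meson DiffI linorder_not_less)
  then have "K \<noteq> {}" by auto
  obtain \<rho> where \<rho>: "\<And>x. x \<in> K \<Longrightarrow> norm x \<le> \<rho>"
    using compact_imp_bounded[OF \<open>compact K\<close>] by (auto simp: bounded_iff)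
  obtain xs where xs: "xs \<in> K" "\<And>x. x \<in> K \<Longrightarrow> v xs \<le> v x"
    using continuous_attains_inf[OF \<open>compact K\<close> \<open>K \<noteq> {}\<close>] continuous_on_subset[OF v_cont] by blast
  define m where "m = - v xs"
  have m: "0 < m" using xs(2)[OF \<open>x1 \<in> K\<close>] x1 by (simp add: m_def v_def)
  obtain \<epsilon> where \<epsilon>: "0 < \<epsilon>" "\<And>x y. norm (y - x) < \<epsilon> \<Longrightarrow> \<bar>v y - v x\<bar> < m / 8"
  proof -
    have "uniformly_continuous_on (cball 0 (\<rho> + 2)) v"
      by (intro compact_uniformly_continuous continuous_on_subset[OF v_cont]) auto
    then obtain d where d: "0 < d" "\<And>x y. x \<in> cball 0 (\<rho> + 2) \<Longrightarrow> y \<in> cball 0 (\<rho> + 2) \<Longrightarrow>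
        dist y x < d \<Longrightarrow> dist (v y) (v x) < m / 8"
      unfolding uniformly_continuous_on_def using m by (metis divide_pos_pos zero_less_numeral)
    show ?thesis
    proof (rule that[of "min d 1"])
      show "0 < min d 1" using d(1) by simp
      fix x y :: 'a assume xy: "norm (y - x) < min d 1"
      show "\<bar>v y - v x\<bar> < m / 8"
      proof (cases "norm x \<le> \<rho> + 2 \<and> norm y \<le> \<rho> + 2")
        case True
        then show ?thesis using d(2)[of x y] xy by (simp add: dist_norm)
      next
        case False
        then have "\<not> norm x \<le> \<rho>" "\<not> norm y \<le> \<rho>"
          using xy norm_triangle_ineq2[of x y] norm_triangle_ineq2[of y x]
          by (auto simp: norm_minus_commute)
        then have "v x = 0" "v y = 0" using v_off_K \<rho> by blast+
        then show ?thesis using m by simp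
      qed
    qed
  qed
  define r where "r = \<epsilon> / 2"
  have r: "0 < r" "r < \<epsilon>" using \<epsilon>(1) by (simp_all add: r_def)
  define I where "I = (\<integral>x. bump r x \<partial>(lborel :: 'a measure))"
  have I: "0 < I" unfolding I_def by (rule integral_bump_pos[OF r(1)])
  define W where "W x = (\<integral>y. w y * bump r (y - x) \<partial>lebesgue)" for x
  have const_int: "integrable lebesgue (\<lambda>y. a * bump r (y - x))"
    "(\<integral>y. a * bump r (y - x) \<partial>lebesgue) = a * I" for a and x :: 'a
    using integral_bump_shift[of r x] r by (simp_all add: I_def)
  \<comment> \<open>Almost everywhere \<open>w \<ge> v\<close>, with equality wherever \<open>v < 0\<close>.\<close>
  have lower: "(v x - m / 8) * I \<le> W x" for x
  proof -
    have "(\<integral>y. (v x - m / 8) * bump r (y - x) \<partial>lebesgue) \<le> W x"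
      unfolding W_def
    proof (rule integral_mono_AE[OF const_int(1) bump_average_integrable[OF w w_int r(1)]])
      show "AE y in lebesgue. (v x - m / 8) * bump r (y - x) \<le> w y * bump r (y - x)"
        using outside
      proof eventually_elim
        case (elim y)
        show ?case
        proof (cases "norm (y - x) < r")
          case True
          have "v y \<le> w y"
            using elim v_off_K[of y] \<open>K \<subseteq> \<Omega>\<close> by (cases "y \<in> K") (auto simp: v_def)
          then have "v x - m / 8 \<le> w y" using \<epsilon>(2)[of y x] True r by linarith
          then show ?thesis by (intro mult_right_mono) auto
        next
          case False
          then show ?thesis using bump_eq_0[of r "y - x"] r by simp
        qed
      qed
    qed
    then show ?thesis by (simp only: const_int)
  qed
  have w_eq_v: "y \<in> \<Omega> \<and> w y < 0 \<and> w y = v y" if "v y < 0" for y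
    using that by (auto simp: v_def min_def split: if_splits)
  have upper: "W xs \<le> (v xs + m / 8) * I"
  proof -
    have "W xs \<le> (\<integral>y. (v xs + m / 8) * bump r (y - xs) \<partial>lebesgue)"
      unfolding W_def
    proof (rule integral_mono_AE[OF bump_average_integrable[OF w w_int r(1)] const_int(1)], rule AE_I2)
      fix y
      show "w y * bump r (y - xs) \<le> (v xs + m / 8) * bump r (y - xs)"
      proof (cases "norm (y - xs) < r")
        case True
        then have "v y \<le> v xs + m / 8" using \<epsilon>(2)[of y xs] r by linarith
        moreover from this have "w y = v y" using w_eq_v[of y] m by (simp add: m_def)
        ultimately show ?thesis by (intro mult_right_mono) auto
      next
        case False
        then show ?thesis using bump_eq_0[of r "y - xs"] r by simp
      qed
    qed
    then show ?thesis by (simp only: const_int)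
  qed
  obtain x0 where x0: "x0 \<in> K" "\<And>x. x \<in> K \<Longrightarrow> W x0 \<le> W x"
    using continuous_attains_inf[OF \<open>compact K\<close> \<open>K \<noteq> {}\<close>, of W]
      continuous_on_subset[OF bump_average_continuous[OF w w_int r(1)]] unfolding W_def by blast
  have W_x0: "W x0 \<le> (- 7 / 8 * m) * I" using x0(2)[OF xs(1)] upper by (simp add: m_def)
  with lower[of x0] have "(v x0 - m / 8) * I \<le> (- 7 / 8 * m) * I" by linarith
  then have "v x0 - m / 8 \<le> - 7 / 8 * m" using I by (simp only: mult_le_cancel_right_pos)
  then have v_x0: "v x0 \<le> - 3 / 4 * m" by linarith
  have "cball x0 r \<subseteq> {x \<in> \<Omega>. w x < 0}"
  proof
    fix y assume "y \<in> cball x0 r"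
    then have "\<bar>v y - v x0\<bar> < m / 8" using r by (intro \<epsilon>(2)) (simp add: dist_norm norm_minus_commute)
    then have "v y < 0" using v_x0 m by linarith
    then show "y \<in> {x \<in> \<Omega>. w x < 0}" using w_eq_v by blast
  qed
  from super[OF r(1) this] have "(\<integral>y. w y * symmetric_op J (\<lambda>x. bump r (x - x0)) y \<partial>lebesgue) \<le> 0" .
  moreover have strict: "W x0 < W x" if "x \<notin> K" for x
  proof -
    have "(- 7 / 8 * m) * I < (- m / 8) * I" using m I by (intro mult_strict_right_mono) auto
    also have "\<dots> \<le> W x" using lower[of x] v_off_K[OF that] by simp
    finally show ?thesis using W_x0 by linarith
  qed
  have "0 < (\<integral>y. w y * symmetric_op J (\<lambda>x. bump r (x - x0)) y \<partial>lebesgue)"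
  proof (rule bump_average_minimum[OF w w_int r(1), folded W_def])
    show "W x0 \<le> W x" for x using strict[of x] x0(2)[of x] by (cases "x \<in> K") auto
    show "W x0 < W x" if "\<rho> < norm x" for x using strict[of x] \<rho>[of x] that by force
  qed
  ultimately show False by linarith
qed

end

section \<open>The comparison principle\<close>

text \<open>If \<open>\<nu>\<close> vanished, so would \<open>\<phi>\<close>, and the quotient in the scaling condition would be \<open>0 / 0 = 0\<close>.\<close>
lemma scaling_condition_nontrivial:
  assumes "complete_bernstein_zero_drift \<phi> \<nu>" "scaling_condition \<phi>"
  shows "\<exists>t>0. \<nu> t \<noteq> 0"
proof (rule ccontr)
  assume "\<not> ?thesis"
  then have "(\<lambda>s. indicator {0<..} s *\<^sub>R ((1 - exp (- (1 * s))) * \<nu> s)) = (\<lambda>s. 0)"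
    by (auto simp: indicator_def fun_eq_iff)
  moreover have "\<phi> 1 = (LBINT s:{0<..}. (1 - exp (- (1 * s))) * \<nu> s)"
    using assms(1) zero_le_one unfolding complete_bernstein_zero_drift_def by blast
  ultimately have "\<phi> 1 = 0" unfolding set_lebesgue_integral_def by simp
  moreover obtain a1 \<delta>1 where "0 < a1" "\<And>l t. 1 \<le> l \<Longrightarrow> 1 \<le> t \<Longrightarrow> a1 * l powr \<delta>1 \<le> \<phi> (l * t) / \<phi> t"
    using assms(2) unfolding scaling_condition_def by blast
  from this(1) this(2)[of 1 1] have "0 < \<phi> 1 / \<phi> 1" by simp
  ultimately show False by simp
qed

lemma (in cm_levy_density) levy_kernel_jump_kernel:
  "levy_kernel (\<lambda>x::'a::euclidean_space. jump_kernel DIM('a) \<nu> (norm x))"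
proof
  show "integrable lborel (\<lambda>h::'a. min 1 ((norm h)\<^sup>2) * jump_kernel DIM('a) \<nu> (norm h))"
    by (rule integrable_jump_kernel)
  obtain C where "\<And>r. 3 \<le> r \<Longrightarrow> jump_kernel DIM('a) \<nu> r \<le> C * jump_kernel DIM('a) \<nu> (r + 1)"
    using jump_kernel_shift by blast
  then show "\<exists>C. \<forall>x y::'a. 3 \<le> norm x \<longrightarrow> norm y = norm x + 1 \<longrightarrow>
      jump_kernel DIM('a) \<nu> (norm x) \<le> C * jump_kernel DIM('a) \<nu> (norm y)"
    by (intro exI[of _ C]) auto
qed (auto intro: jump_kernel_nonneg jump_kernel_pos jump_kernel_antimono)

lemma (in levy_test) levy_op_eq_symmetric_op:
  assumes "\<And>x. J x = jump_kernel DIM('a) \<nu> (norm x)"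
  shows "levy_op \<nu> \<xi> y = symmetric_op J \<xi> y"
  unfolding levy_op_def assms[symmetric]
  by (rule tendsto_Lim[OF _ truncated_integral_tendsto]) simp

lemma integrable_weighted_measure:
  fixes u :: "'a::euclidean_space \<Rightarrow> real"
  assumes "integrable (weighted_measure \<nu>) u"
    and J: "levy_kernel (\<lambda>x::'a. jump_kernel DIM('a) \<nu> (norm x))"
  shows "u \<in> borel_measurable lebesgue"
    and "integrable lebesgue (\<lambda>x. min 1 (jump_kernel DIM('a) \<nu> (norm x)) * u x)"
proof -
  interpret levy_kernel "\<lambda>x::'a. jump_kernel DIM('a) \<nu> (norm x)" by (rule J)
  show u: "u \<in> borel_measurable lebesgue"
    using borel_measurable_integrable[OF assms(1)] by (simp add: weighted_measure_def)
  have "(\<lambda>x::'a. min 1 (jump_kernel DIM('a) \<nu> (norm x))) \<in> borel_measurable lebesgue"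
    by (rule measurable_completion) measurable
  from integrable_density[OF u this] show "integrable lebesgue (\<lambda>x. min 1 (jump_kernel DIM('a) \<nu> (norm x)) * u x)"
    using assms(1) J_nonneg by (simp add: weighted_measure_def)
qed

lemma set_integrable_times_bump:
  fixes g :: "'a::euclidean_space \<Rightarrow> real"
  assumes "continuous_on \<Omega> g" "0 \<le> r" "cball c r \<subseteq> \<Omega>"
  shows "set_integrable lebesgue \<Omega> (\<lambda>x. g x * bump r (x - c))"
proof -
  have "continuous_on (cball c r) (\<lambda>x. g x * bump r (x - c))"
    using assms continuous_on_subset[OF bump_continuous]
    by (intro continuous_intros continuous_on_compose2[OF bump_continuous]) (auto intro: continuous_on_subset)
  then have int: "integrable lborel (\<lambda>x. indicator (cball c r) x *\<^sub>R (g x * bump r (x - c)))"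
    by (intro borel_integrable_compact) auto
  then have "integrable lebesgue (\<lambda>x. indicator (cball c r) x *\<^sub>R (g x * bump r (x - c)))"
    using integrable_completion[OF borel_measurable_integrable[OF int]] by simp
  also have "(\<lambda>x. indicator (cball c r) x *\<^sub>R (g x * bump r (x - c))) = (\<lambda>x. indicator \<Omega> x *\<^sub>R (g x * bump r (x - c)))"
  proof
    fix x
    show "indicator (cball c r) x *\<^sub>R (g x * bump r (x - c)) = indicator \<Omega> x *\<^sub>R (g x * bump r (x - c))"
      using assms bump_eq_0[of r "x - c"]
      by (cases "x \<in> cball c r") (auto simp: dist_norm norm_minus_commute)
  qed
  finally show ?thesis by (simp add: set_integrable_def)
qed

theorem lemma3p11:
  fixes \<phi> \<nu> f :: "real \<Rightarrow> real"
    and \<Omega> B :: "'a::euclidean_space set"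
    and u1 u2 :: "'a \<Rightarrow> real"
  assumes "DIM('a) \<ge> 2"
    and "complete_bernstein_zero_drift \<phi> \<nu>"
    and "scaling_condition \<phi>"
    and "admissible_nonlinearity f"
    and "bounded \<Omega>" and "C11_open \<Omega>"
    and "open B" and "compact (closure B)" and "closure B \<subseteq> \<Omega>"
    and "integrable (weighted_measure \<nu>) u1" and "continuous_on \<Omega> u1"
    and "integrable (weighted_measure \<nu>) u2" and "continuous_on \<Omega> u2"
    and "distributional_supersolution \<nu> f \<Omega> u1"
    and "distributional_subsolution \<nu> f \<Omega> u2"
    and "AE x in lebesgue. x \<notin> B \<longrightarrow> u1 x \<ge> u2 x"
  shows "\<forall>x\<in>\<Omega>. u1 x \<ge> u2 x"
proof -
  define J where "J = (\<lambda>x::'a. jump_kernel DIM('a) \<nu> (norm x))"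
  have "cm_levy_density \<nu>"
    using assms(2) scaling_condition_nontrivial[OF assms(2,3)]
    unfolding complete_bernstein_zero_drift_def by unfold_locales auto
  then have J: "levy_kernel J" unfolding J_def by (rule cm_levy_density.levy_kernel_jump_kernel)
  interpret levy_kernel J by (rule J)
  have u1: "u1 \<in> borel_measurable lebesgue" "integrable lebesgue (\<lambda>x. min 1 (J x) * u1 x)"
    using integrable_weighted_measure[OF assms(10) J[unfolded J_def]] by (simp_all add: J_def)
  have u2: "u2 \<in> borel_measurable lebesgue" "integrable lebesgue (\<lambda>x. min 1 (J x) * u2 x)"
    using integrable_weighted_measure[OF assms(12) J[unfolded J_def]] by (simp_all add: J_def)
  have f_mono: "mono f" and "\<forall>t. f differentiable (at t)"
    using assms(4) unfolding admissible_nonlinearity_def by blast+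
  then have f_cont: "continuous_on UNIV f"
    by (auto intro!: continuous_at_imp_continuous_on differentiable_imp_continuous_within)
  have "\<forall>x\<in>\<Omega>. 0 \<le> u1 x - u2 x"
  proof (rule maximum_principle)
    show "(\<lambda>x. u1 x - u2 x) \<in> borel_measurable lebesgue"
      by (intro borel_measurable_diff u1 u2)
    show "integrable lebesgue (\<lambda>y. min 1 (J y) * (u1 y - u2 y))"
      using Bochner_Integration.integrable_diff[OF u1(2) u2(2)] by (simp only: right_diff_distrib)
    show "open \<Omega>" using assms(6) by (simp add: C11_open_def)
    show "compact (closure B)" "closure B \<subseteq> \<Omega>" by fact+
    show "continuous_on \<Omega> (\<lambda>x. u1 x - u2 x)" using assms by (intro continuous_intros)
    show "AE x in lebesgue. x \<notin> closure B \<longrightarrow> 0 \<le> u1 x - u2 x"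
      using assms(16) closure_subset[of B] by (auto elim!: eventually_mono)
  next
    fix c :: 'a and r :: real
    assume r: "0 < r" and sub: "cball c r \<subseteq> {x \<in> \<Omega>. u1 x - u2 x < 0}"
    define \<xi> where "\<xi> = (\<lambda>x. bump r (x - c))"
    have \<xi>: "\<xi> \<in> test_functions \<Omega>"
      unfolding \<xi>_def using r sub by (intro bump_shift_test_function) auto
    obtain A M R where "levy_test J \<xi> A M R" unfolding \<xi>_def using bump_levy_test[OF r] by blast
    then interpret levy_test J \<xi> A M R .
    have op: "levy_op \<nu> \<xi> = symmetric_op J \<xi>"
      using levy_op_eq_symmetric_op by (auto simp: J_def)
    have int: "set_integrable lebesgue \<Omega> (\<lambda>x. f (u x) * \<xi> x)" if "continuous_on \<Omega> u" for u
      unfolding \<xi>_def using r sub that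
      by (intro set_integrable_times_bump continuous_on_compose2[OF f_cont]) auto
    have "(\<integral>x. (u1 x - u2 x) * symmetric_op J \<xi> x \<partial>lebesgue)
        = (\<integral>x. u1 x * symmetric_op J \<xi> x \<partial>lebesgue) - (\<integral>x. u2 x * symmetric_op J \<xi> x \<partial>lebesgue)"
      unfolding left_diff_distrib
      by (rule Bochner_Integration.integral_diff) (intro symmetric_op_integrable u1 u2)+
    also have "\<dots> \<le> (LINT x:\<Omega>|lebesgue. f (u1 x) * \<xi> x) - (LINT x:\<Omega>|lebesgue. f (u2 x) * \<xi> x)"
    proof -
      have "(LINT x|lebesgue. u1 x * (- levy_op \<nu> \<xi> x)) \<ge> - (LINT x:\<Omega>|lebesgue. f (u1 x) * \<xi> x)"
        using assms(14) \<xi> xi_nonneg unfolding distributional_supersolution_def by blast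
      moreover have "(LINT x|lebesgue. u2 x * (- levy_op \<nu> \<xi> x)) \<le> - (LINT x:\<Omega>|lebesgue. f (u2 x) * \<xi> x)"
        using assms(15) \<xi> xi_nonneg unfolding distributional_subsolution_def by blast
      ultimately show ?thesis by (simp add: op)
    qed
    also have "\<dots> \<le> 0"
    proof -
      have "(LINT x:\<Omega>|lebesgue. f (u1 x) * \<xi> x) \<le> (LINT x:\<Omega>|lebesgue. f (u2 x) * \<xi> x)"
      proof (rule set_integral_mono)
        show "f (u1 x) * \<xi> x \<le> f (u2 x) * \<xi> x" for x
        proof (cases "x \<in> cball c r")
          case True
          then have "u1 x \<le> u2 x" using sub by force
          then show ?thesis using xi_nonneg by (intro mult_right_mono monoD[OF f_mono])
        next
          case False
          then have "\<xi> x = 0"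
            unfolding \<xi>_def using r by (intro bump_eq_0) (auto simp: dist_norm norm_minus_commute)
          then show ?thesis by simp
        qed
      qed (intro int assms)+
      then show ?thesis by simp
    qed
    finally show "(\<integral>y. (u1 y - u2 y) * symmetric_op J (\<lambda>x. bump r (x - c)) y \<partial>lebesgue) \<le> 0"
      by (simp add: \<xi>_def)
  qed
  then show ?thesis by simp
qed

end
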